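(* (Sharp growth estimate.) Assume $c$, $\Omega$, $\bar\Omega$, $\operatorname{spt}\rho$, $\operatorname{spt}\bar\rho$ satisfy (Twist), (Nondeg), (DomConv) and (QQConv), with constant $M_0$ in (QQConv). There is a universal constant $C>0$ with the following property. Let $u$ be a $c$-convex function on $\Omega$ and let $m$ be a $c$-function with focus $\bar x\in\bar\Omega$ such that $S:=\{x\in\Omega: u(x)\le m(x)\}$ has positive measure. Then for any set $A\subset\Omega$ (of positive measure, so that its dilation is defined) which is $c$-convex with respect to $\bar x$ and satisfies $$(2M_0A)^{\bar x}\subset S,$$ we have $$\sup_S(m-u)^n\ \ge\ C^{-1}\,|A|_{\mathcal L}\,|\partial_cu(A)|_{\mathcal L}.$$
   Context: Setting. $(M,g)$ and $(\bar M,\bar g)$ are $n$-dimensional Riemannian manifolds, $\Omega\subset M$ and $\bar\Omega\subset\bar M$ are bounded subdomains with compact closures $\Omega^{\mathrm{cl}},\bar\Omega^{\mathrm{cl}}$. $\rho,\bar\rho\ge 0$ are measurable functions (densities of probability measures on $M$, $\bar M$) with supports $\operatorname{spt}\rho\subset\Omega$, $\operatorname{spt}\bar\rho\subset\bar\Omega$; $0<\alpha_1\le\alpha_2$ are fixed constants with $\alpha_1\le\rho(x)/\bar\rho(\bar x)\le\alpha_2$ a.e. on the product of the supports. $|\cdot|_{\mathcal L}$ denotes Riemannian volume. The cost $c:\Omega^{\mathrm{cl}}\times\bar\Omega^{\mathrm{cl}}\to\mathbb R$ is "$C^3$" in the sense that all mixed derivatives of order 2 in one variable and order 1 in the other are continuous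 on $\Omega^{\mathrm{cl}}\times\bar\Omega^{\mathrm{cl}}$. $D$ and $\bar D$ denote the differentials in the first and second variable. Notation: $p_{(x,\bar x)}:=-\bar Dc(x,\bar x)\in T^*_{\bar x}\bar M$, $\bar p_{(x,\bar x)}:=-Dc(x,\bar x)\in T^*_xM$; for $A\subset\Omega$, $[A]_{\bar x}:=-\bar Dc(A,\bar x)$; for $\bar A\subset\bar\Omega$, $[\bar A]_x:=-Dc(x,\bar A)$. (Twist): $\bar x\mapsto -Dc(x_0,\bar x)$ is injective on $\bar\Omega$ for each $x_0\in\Omega$, and $x\mapsto-\bar Dc(x,\bar x_0)$ is injective on $\Omega$ for each $\bar x_0\in\bar\Omega$. For $\bar p\in[\bar\Omega]_{x_0}$, $exp^c_{x_0}(\bar p)\in\bar\Omega$ is the unique point with $-Dc(x_0,exp^c_{x_0}(\bar p))=\bar p$; for $p\in[\Omega]_{\bar x_0}$, $exp^c_{\bar x_0}(p)\in\Omega$ is the unique point with $-\bar Dc(exp^c_{\bar x_0}(p),\bar x_0)=p$. (Nondeg): for every $(x,\bar x)\in\Omega^{\mathrm{cl}}\times\bar\Omega^{\mathrm{cl}}$ the linear maps $-\bar DDc(x,\bar x):T_{\bar x}\bar M\to T^*_xM$ and its adjoint $-D\bar Dc(x,\bar x):T_xM\to T^*_{\bar x}\bar M$ are invertible. Put $\mathcal M_{x,\bar x}:=[-\bar DDc(x,\bar x)]^{-1}:T^*_xM\to T_{\bar x}\bar M$. $c$-segments: for $x_0,x_1\in\Omega$ and $\bar x\in\bar\Omega$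 the $c$-segment with respect to $\bar x$ from $x_0$ to $x_1$ is $s\mapsto exp^c_{\bar x}((1-s)p_{(x_0,\bar x)}+s\,p_{(x_1,\bar x)})$, $s\in[0,1]$; for $\bar x_0,\bar x_1\in\bar\Omega$ and $x\in\Omega$ the $c$-segment with respect to $x$ from $\bar x_0$ to $\bar x_1$ is $t\mapsto exp^c_x((1-t)\bar p_{(x,\bar x_0)}+t\,\bar p_{(x,\bar x_1)})$. A set $A\subset\Omega$ is $c$-convex with respect to $\bar x$ if it contains all $c$-segments with respect to $\bar x$ between its points (equivalently $[A]_{\bar x}$ is convex); similarly for $\bar A\subset\bar\Omega$ with respect to $x\in\Omega$; $c$-convex with respect to a set means with respect to each of its points. (DomConv): $\Omega$ and $\bar\Omega$ are $c$-convex with respect to each other, $\operatorname{spt}\bar\rho$ is $c$-convex with respect to $\Omega$, and $\operatorname{spt}\bar\rho\subset\bar\Omega^{\mathrm{int}}$ (compact containment). (QQConv): there is a constant $M_0\ge1$ such that for all $x,x_0,x_1\in\Omega$, $\bar x,\bar x_0,\bar x_1\in\bar\Omega$ and $s,t\in[0,1]$, $$-c(x,\bar x(t))+c(x,\bar x_0)-(-c(x_0,\bar x(t))+c(x_0,\bar x_0))\le M_0t\,\big(-c(x,\bar x_1)+c(x,\bar x_0)-(-c(x_0,\bar x_1)+c(x_0,\bar x_0))\big)_+,$$ $$-c(x(s),\bar x)+c(x_0,\bar x)-(-c(x(s),\bar x_0)+c(x_0,\bar x_0))\le M_0s\,\big(-c(x_1,\bar x)+c(x_0,\bar x)-(-c(x_1,\bar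 x_0)+c(x_0,\bar x_0))\big)_+,$$ where $\bar x(t)$ is the $c$-segment with respect to $x_0$ from $\bar x_0$ to $\bar x_1$, and $x(s)$ is the $c$-segment with respect to $\bar x_0$ from $x_0$ to $x_1$. Universal constant: one depending only on $\Omega,\bar\Omega,\operatorname{spt}\rho,\operatorname{spt}\bar\rho$, $n$, $\alpha_1,\alpha_2$, $M_0$ (itself regarded as universal), $\sup|\det\mathcal M_{x,\bar x}|^{\pm1}$ and $\sup\|\mathcal M_{x,\bar x}^{\pm1}\|$ over $\Omega^{\mathrm{cl}}\times\bar\Omega^{\mathrm{cl}}$, and $\|c\|_{C^3(\Omega^{\mathrm{cl}}\times\bar\Omega^{\mathrm{cl}})}$. $c$-convex functions: a $c$-function with focus $\bar x_0\in\bar\Omega$ is a function $m(x)=-c(x,\bar x_0)+\lambda_0$, $\lambda_0\in\mathbb R$. A real function $u$ on $\Omega$ is $c$-convex if for each $x_0\in\Omega$ there is a $c$-function $m$ with $m(x_0)=u(x_0)$ and $m\le u$ on $\Omega$; such $m$ is supporting to $u$ at $x_0$. $\partial_cu(x)$ is the set of $\bar x\in\bar\Omega$ for which there is a $c$-function with focus $\bar x$ supporting to $u$ at $x$, and $\partial_cu(A)=\bigcup_{x\in A}\partial_cu(x)$. Center of mass: for a bounded convex set $\mathcal A$ with nonempty interior in an $n$-dimensional Euclidean space, the John ellipsoid $\mathcal E$, with center $p_{cm}$ (called the center of mass of $\mathcal A$), is the unique ellipsoid such that $\mathcal E\subset\mathcal A\subset p_{cm}+n(\mathcal E-p_{cm})$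 and $p_{cm}+n(\mathcal E-p_{cm})$ is the ellipsoid of smallest volume containing $\mathcal A$. Dilation: if $A\subset\Omega$ has positive measure and is $c$-convex with respect to $\bar x$, then for $\kappa>0$, $(\kappa A)^{\bar x}:=exp^c_{\bar x}\big(p_{cm}+\kappa([A]_{\bar x}-p_{cm})\big)$, where $p_{cm}$ is the center of mass of $[A]_{\bar x}$ (the inclusion $(2M_0A)^{\bar x}\subset S$ includes that the dilated set lies in $[\Omega]_{\bar x}$). *)

theory Defs
  imports "HOL-Analysis.Analysis"
begin

subsection \<open>Riemannian manifolds, described in charts\<close>

fun Ck_on :: "nat \<Rightarrow> 'v::real_normed_vector set \<Rightarrow> ('v \<Rightarrow> 'w::real_normed_vector) \<Rightarrow> bool" where
  "Ck_on 0 S f \<longleftrightarrow> continuous_on S f"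
| "Ck_on (Suc k) S f \<longleftrightarrow> (\<forall>x\<in>S. f differentiable (at x)) \<and>
     (\<forall>v. Ck_on k S (\<lambda>x. frechet_derivative f (at x) v))"

definition smooth_on :: "'v::real_normed_vector set \<Rightarrow> ('v \<Rightarrow> 'w::real_normed_vector) \<Rightarrow> bool" where
  "smooth_on S f \<longleftrightarrow> (\<forall>k. Ck_on k S f)"

text \<open>A chart is a pair of its domain and its coordinate map (only the values on the domain
  matter).\<close>

type_synonym ('a, 'n) chart = "'a set \<times> ('a \<Rightarrow> real ^ 'n)"

definition chart_inv :: "('a, 'n::finite) chart \<Rightarrow> real ^ 'n \<Rightarrow> 'a" where
  "chart_inv A = inv_into (fst A) (snd A)"

definition is_chart :: "('a::topological_space, 'n::finite) chart \<Rightarrow> bool" where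
  "is_chart A \<longleftrightarrow> open (fst A) \<and> open (snd A ` fst A) \<and>
     homeomorphism (fst A) (snd A ` fst A) (snd A) (chart_inv A)"

text \<open>The manifold is the whole type \<^typ>\<open>'a\<close>. \<open>gmat M A x\<close> is the Gram matrix of the metric
  at the point \<open>x\<close> in the coordinates of the chart \<open>A\<close>.\<close>

record ('a, 'n) riem =
  atlas :: "('a, 'n) chart set"
  gmat :: "('a, 'n) chart \<Rightarrow> 'a \<Rightarrow> real ^ 'n ^ 'n"

definition riemannian_manifold ::
  "('a::{t2_space,second_countable_topology}, 'n::finite) riem \<Rightarrow> bool" where
  "riemannian_manifold M \<longleftrightarrow>
     (\<forall>A\<in>atlas M. is_chart A) \<and>
     (\<Union>A\<in>atlas M. fst A) = UNIV \<and>
     (\<forall>A\<in>atlas M. \<forall>B\<in>atlas M.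
        smooth_on (snd A ` (fst A \<inter> fst B)) (snd B \<circ> chart_inv A)) \<and>
     (\<forall>A\<in>atlas M. smooth_on (snd A ` fst A) (gmat M A \<circ> chart_inv A)) \<and>
     (\<forall>A\<in>atlas M. \<forall>x\<in>fst A. transpose (gmat M A x) = gmat M A x \<and>
        (\<forall>v. v \<noteq> 0 \<longrightarrow> v \<bullet> (gmat M A x *v v) > 0)) \<and>
     (\<forall>A\<in>atlas M. \<forall>B\<in>atlas M. \<forall>x\<in>fst A \<inter> fst B.
        (let J = jacobian (snd B \<circ> chart_inv A) (at (snd A x))
         in gmat M A x = transpose J ** gmat M B x ** J))"

text \<open>The Riemannian volume is the unique Borel measure with density \<open>sqrt (det g)\<close> in every
  chart. The volume of a set that need not be Borel is \<^const>\<open>outer_measure_of\<close>, which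
  agrees with the completed measure on all sets measurable for the latter.\<close>

definition riemannian_volume ::
  "('a::{t2_space,second_countable_topology}, 'n::finite) riem \<Rightarrow> 'a measure \<Rightarrow> bool" where
  "riemannian_volume M \<mu> \<longleftrightarrow> sets \<mu> = sets borel \<and>
     (\<forall>A\<in>atlas M. \<forall>E\<in>sets borel. E \<subseteq> fst A \<longrightarrow>
        emeasure \<mu> E = (\<integral>\<^sup>+ y. ennreal (sqrt (det (gmat M A (chart_inv A y)))) *
                              indicator (snd A ` E) y \<partial>lborel))"

text \<open>Tangent and cotangent vectors at \<open>x\<close> are represented by their coordinates; where a single
  model of the (co)tangent space at \<open>x\<close> is needed, the coordinates of one fixed chart around
  \<open>x\<close> are used. All notions applied to these models below (injectivity, convexity, affine
  combinations, John ellipsoids) are invariant under linear isomorphisms.\<close>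

definition chart_at :: "('a, 'n::finite) riem \<Rightarrow> 'a \<Rightarrow> ('a, 'n) chart" where
  "chart_at M x = (SOME A. A \<in> atlas M \<and> x \<in> fst A)"

definition tangent_norm :: "('a, 'n::finite) riem \<Rightarrow> ('a, 'n) chart \<Rightarrow> 'a \<Rightarrow> real ^ 'n \<Rightarrow> real" where
  "tangent_norm M A x v = sqrt (v \<bullet> (gmat M A x *v v))"

definition cotangent_norm :: "('a, 'n::finite) riem \<Rightarrow> ('a, 'n) chart \<Rightarrow> 'a \<Rightarrow> real ^ 'n \<Rightarrow> real" where
  "cotangent_norm M A x p = sqrt (p \<bullet> (matrix_inv (gmat M A x) *v p))"

definition chart_differentiable :: "('a, 'n::finite) chart \<Rightarrow> ('a \<Rightarrow> real) \<Rightarrow> 'a \<Rightarrow> bool" where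
  "chart_differentiable A f x \<longleftrightarrow> (f \<circ> chart_inv A) differentiable (at (snd A x))"

definition chart_pd :: "('a, 'n::finite) chart \<Rightarrow> 'n \<Rightarrow> ('a \<Rightarrow> real) \<Rightarrow> 'a \<Rightarrow> real" where
  "chart_pd A i f x = frechet_derivative (f \<circ> chart_inv A) (at (snd A x)) (axis i 1)"

text \<open>Christoffel symbols \<open>\<Gamma>\<^sup>l\<^sub>k\<^sub>i\<close> of the Levi-Civita connection.\<close>

definition christoffel ::
  "('a, 'n::finite) riem \<Rightarrow> ('a, 'n) chart \<Rightarrow> 'n \<Rightarrow> 'n \<Rightarrow> 'n \<Rightarrow> 'a \<Rightarrow> real" where
  "christoffel M A l k i x = (\<Sum>m\<in>UNIV. matrix_inv (gmat M A x) $ l $ m *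
     (chart_pd A k (\<lambda>z. gmat M A z $ m $ i) x + chart_pd A i (\<lambda>z. gmat M A z $ m $ k) x
      - chart_pd A m (\<lambda>z. gmat M A z $ k $ i) x)) / 2"

definition domain_with_compact_closure :: "'a::topological_space set \<Rightarrow> bool" where
  "domain_with_compact_closure W \<longleftrightarrow> W \<noteq> {} \<and> open W \<and> connected W \<and> compact (closure W)"

definition measure_support :: "'a::topological_space measure \<Rightarrow> 'a set" where
  "measure_support \<nu> = {x. \<forall>U. open U \<and> x \<in> U \<longrightarrow> emeasure \<nu> U > 0}"

definition prob_density_with_support ::
  "'a::topological_space measure \<Rightarrow> ('a \<Rightarrow> real) \<Rightarrow> 'a set \<Rightarrow> bool" where
  "prob_density_with_support \<mu> r X \<longleftrightarrow> r \<in> borel_measurable \<mu> \<and> (\<forall>x. r x \<ge> 0) \<and>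
     emeasure (density \<mu> (\<lambda>x. ennreal (r x))) UNIV = 1 \<and>
     measure_support (density \<mu> (\<lambda>x. ennreal (r x))) = X"


subsection \<open>The cost and its derivatives\<close>

text \<open>Iterated partial derivatives in the charts \<open>A\<close>, \<open>B\<close>. A word in \<open>'n + 'n\<close> is read as a
  composition of operators (its last letter is applied first); \<open>Inl i\<close> differentiates in the
  first variable, \<open>Inr j\<close> in the second.\<close>

fun cost_pd :: "('a, 'n::finite) chart \<Rightarrow> ('b, 'n) chart \<Rightarrow> ('a \<Rightarrow> 'b \<Rightarrow> real) \<Rightarrow>
    ('n + 'n) list \<Rightarrow> 'a \<Rightarrow> 'b \<Rightarrow> real" where
  "cost_pd A B c [] x y = c x y"
| "cost_pd A B c (Inl i # w) x y = chart_pd A i (\<lambda>x'. cost_pd A B c w x' y) x"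
| "cost_pd A B c (Inr j # w) x y = chart_pd B j (\<lambda>y'. cost_pd A B c w x y') y"

fun cost_pd_exists :: "('a, 'n::finite) chart \<Rightarrow> ('b, 'n) chart \<Rightarrow> ('a \<Rightarrow> 'b \<Rightarrow> real) \<Rightarrow>
    ('n + 'n) list \<Rightarrow> 'a \<Rightarrow> 'b \<Rightarrow> bool" where
  "cost_pd_exists A B c [] x y = True"
| "cost_pd_exists A B c (Inl i # w) x y = chart_differentiable A (\<lambda>x'. cost_pd A B c w x' y) x"
| "cost_pd_exists A B c (Inr j # w) x y = chart_differentiable B (\<lambda>y'. cost_pd A B c w x y') y"

text \<open>Values on the closure of the product domain are the continuous extensions of the values
  inside. Continuity of \<open>ext_closure W F\<close> on the closure of \<open>W\<close> says that \<open>F\<close> is continuous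
  on \<open>W\<close> and extends continuously to the closure.\<close>

definition ext_closure ::
  "'z::topological_space set \<Rightarrow> ('z \<Rightarrow> real) \<Rightarrow> 'z \<Rightarrow> real" where
  "ext_closure W F z = (if z \<in> W then F z else Lim (at z within W) F)"

definition cost_pd_cl :: "'a::topological_space set \<Rightarrow> 'b::topological_space set \<Rightarrow>
    ('a, 'n::finite) chart \<Rightarrow> ('b, 'n) chart \<Rightarrow> ('a \<Rightarrow> 'b \<Rightarrow> real) \<Rightarrow>
    ('n + 'n) list \<Rightarrow> 'a \<Rightarrow> 'b \<Rightarrow> real" where
  "cost_pd_cl \<Omega> \<Omega>' A B c w x y =
     ext_closure (\<Omega> \<times> \<Omega>') (\<lambda>(x, y). cost_pd A B c w x y) (x, y)"

text \<open>The derivatives of first order, of second order \<open>(1,1)\<close>, and of third order \<open>(2,1)\<close> and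
  \<open>(1,2)\<close>. Pure second derivatives are not required to exist.\<close>

definition C3_word :: "('n + 'n) list \<Rightarrow> bool" where
  "C3_word w \<longleftrightarrow> length w \<le> 1 \<or> (\<exists>d e. w = [d, e] \<and> isl d \<noteq> isl e) \<or>
     (\<exists>b d e. w = [b, d, e] \<and> isl d \<noteq> isl e)"

definition C3_cost :: "('a::topological_space, 'n::finite) riem \<Rightarrow>
    ('b::topological_space, 'n) riem \<Rightarrow> 'a set \<Rightarrow> 'b set \<Rightarrow> ('a \<Rightarrow> 'b \<Rightarrow> real) \<Rightarrow> bool" where
  "C3_cost M M' \<Omega> \<Omega>' c \<longleftrightarrow>
     continuous_on (closure \<Omega> \<times> closure \<Omega>') (\<lambda>(x, y). c x y) \<and>
     (\<forall>A\<in>atlas M. \<forall>B\<in>atlas M'. \<forall>w. C3_word w \<longrightarrow>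
        (\<forall>x\<in>\<Omega> \<inter> fst A. \<forall>y\<in>\<Omega>' \<inter> fst B. cost_pd_exists A B c w x y) \<and>
        continuous_on ((closure \<Omega> \<inter> fst A) \<times> (closure \<Omega>' \<inter> fst B))
          (\<lambda>(x, y). cost_pd_cl \<Omega> \<Omega>' A B c w x y))"

text \<open>Matrices of \<open>-D'Dc : T\<^sub>yM' \<rightarrow> T\<^sup>*\<^sub>xM\<close> (row index: first variable) and of
  \<open>-DD'c : T\<^sub>xM \<rightarrow> T\<^sup>*\<^sub>yM'\<close> (row index: second variable).\<close>

definition mixed_matrix :: "'a::topological_space set \<Rightarrow> 'b::topological_space set \<Rightarrow>
    ('a, 'n::finite) chart \<Rightarrow> ('b, 'n) chart \<Rightarrow> ('a \<Rightarrow> 'b \<Rightarrow> real) \<Rightarrow> 'a \<Rightarrow> 'b \<Rightarrow> real ^ 'n ^ 'n" where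
  "mixed_matrix \<Omega> \<Omega>' A B c x y = (\<chi> i j. - cost_pd_cl \<Omega> \<Omega>' A B c [Inr j, Inl i] x y)"

definition mixed_matrix_adj :: "'a::topological_space set \<Rightarrow> 'b::topological_space set \<Rightarrow>
    ('a, 'n::finite) chart \<Rightarrow> ('b, 'n) chart \<Rightarrow> ('a \<Rightarrow> 'b \<Rightarrow> real) \<Rightarrow> 'a \<Rightarrow> 'b \<Rightarrow> real ^ 'n ^ 'n" where
  "mixed_matrix_adj \<Omega> \<Omega>' A B c x y = (\<chi> j i. - cost_pd_cl \<Omega> \<Omega>' A B c [Inl i, Inr j] x y)"

definition Nondeg :: "('a::topological_space, 'n::finite) riem \<Rightarrow>
    ('b::topological_space, 'n) riem \<Rightarrow> 'a set \<Rightarrow> 'b set \<Rightarrow> ('a \<Rightarrow> 'b \<Rightarrow> real) \<Rightarrow> bool" where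
  "Nondeg M M' \<Omega> \<Omega>' c \<longleftrightarrow>
     (\<forall>A\<in>atlas M. \<forall>B\<in>atlas M'. \<forall>x\<in>closure \<Omega> \<inter> fst A. \<forall>y\<in>closure \<Omega>' \<inter> fst B.
        invertible (mixed_matrix \<Omega> \<Omega>' A B c x y) \<and>
        invertible (mixed_matrix_adj \<Omega> \<Omega>' A B c x y))"

text \<open>The determinant of the inverse mixed matrix with respect to orthonormal bases of
  \<open>T\<^sup>*\<^sub>xM\<close> and \<open>T\<^sub>yM'\<close> (up to sign): the change from the coordinate bases contributes the
  factors \<open>sqrt (det g)\<close> and \<open>sqrt (det g')\<close>.\<close>

definition inv_mixed_det :: "('a::topological_space, 'n::finite) riem \<Rightarrow>
    ('b::topological_space, 'n) riem \<Rightarrow> 'a set \<Rightarrow> 'b set \<Rightarrow> ('a, 'n) chart \<Rightarrow> ('b, 'n) chart \<Rightarrow>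
    ('a \<Rightarrow> 'b \<Rightarrow> real) \<Rightarrow> 'a \<Rightarrow> 'b \<Rightarrow> real" where
  "inv_mixed_det M M' \<Omega> \<Omega>' A B c x y =
     \<bar>det (matrix_inv (mixed_matrix \<Omega> \<Omega>' A B c x y))\<bar> *
       sqrt (det (gmat M A x)) * sqrt (det (gmat M' B y))"

definition mixed_bounds :: "('a::topological_space, 'n::finite) riem \<Rightarrow>
    ('b::topological_space, 'n) riem \<Rightarrow> 'a set \<Rightarrow> 'b set \<Rightarrow> ('a \<Rightarrow> 'b \<Rightarrow> real) \<Rightarrow> real \<Rightarrow> bool" where
  "mixed_bounds M M' \<Omega> \<Omega>' c K \<longleftrightarrow>
     (\<forall>A\<in>atlas M. \<forall>B\<in>atlas M'. \<forall>x\<in>closure \<Omega> \<inter> fst A. \<forall>y\<in>closure \<Omega>' \<inter> fst B.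
        inv_mixed_det M M' \<Omega> \<Omega>' A B c x y \<le> K \<and>
        inverse (inv_mixed_det M M' \<Omega> \<Omega>' A B c x y) \<le> K \<and>
        (\<forall>p. tangent_norm M' B y (matrix_inv (mixed_matrix \<Omega> \<Omega>' A B c x y) *v p)
               \<le> K * cotangent_norm M A x p) \<and>
        (\<forall>v. cotangent_norm M A x (mixed_matrix \<Omega> \<Omega>' A B c x y *v v)
               \<le> K * tangent_norm M' B y v))"

text \<open>\<open>C3_norm_le \<dots> K\<close> says that the tensors \<open>c\<close>, \<open>Dc\<close>, \<open>D'c\<close>, \<open>DD'c\<close>, \<open>\<nabla>DD'c\<close> and
  \<open>\<nabla>'D'Dc\<close> (covariant derivatives of the Levi-Civita connections) are bounded by \<open>K\<close> on the
  closed product domain, in the operator norm given by the metrics.\<close>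

definition C3_norm_le :: "('a::topological_space, 'n::finite) riem \<Rightarrow>
    ('b::topological_space, 'n) riem \<Rightarrow> 'a set \<Rightarrow> 'b set \<Rightarrow> ('a \<Rightarrow> 'b \<Rightarrow> real) \<Rightarrow> real \<Rightarrow> bool" where
  "C3_norm_le M M' \<Omega> \<Omega>' c K \<longleftrightarrow>
     (\<forall>x\<in>closure \<Omega>. \<forall>y\<in>closure \<Omega>'. \<bar>c x y\<bar> \<le> K) \<and>
     (\<forall>A\<in>atlas M. \<forall>B\<in>atlas M'. \<forall>x\<in>closure \<Omega> \<inter> fst A. \<forall>y\<in>closure \<Omega>' \<inter> fst B.
        let d = (\<lambda>w. cost_pd_cl \<Omega> \<Omega>' A B c w x y);
            T = (\<lambda>k i j. d [Inl k, Inl i, Inr j]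
                   - (\<Sum>l\<in>UNIV. christoffel M A l k i x * d [Inl l, Inr j]));
            T' = (\<lambda>k j i. d [Inr k, Inr j, Inl i]
                   - (\<Sum>l\<in>UNIV. christoffel M' B l k j y * d [Inr l, Inl i]))
        in
          cotangent_norm M A x (\<chi> i. d [Inl i]) \<le> K \<and>
          cotangent_norm M' B y (\<chi> j. d [Inr j]) \<le> K \<and>
          (\<forall>v v'. \<bar>\<Sum>i\<in>UNIV. \<Sum>j\<in>UNIV. v $ i * v' $ j * d [Inl i, Inr j]\<bar>
             \<le> K * tangent_norm M A x v * tangent_norm M' B y v') \<and>
          (\<forall>v w v'. \<bar>\<Sum>k\<in>UNIV. \<Sum>i\<in>UNIV. \<Sum>j\<in>UNIV. v $ k * w $ i * v' $ j * T k i j\<bar>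
             \<le> K * tangent_norm M A x v * tangent_norm M A x w * tangent_norm M' B y v') \<and>
          (\<forall>v' w' v. \<bar>\<Sum>k\<in>UNIV. \<Sum>j\<in>UNIV. \<Sum>i\<in>UNIV. v' $ k * w' $ j * v $ i * T' k j i\<bar>
             \<le> K * tangent_norm M' B y v' * tangent_norm M' B y w' * tangent_norm M A x v))"


subsection \<open>c-exponential map and c-convexity\<close>

text \<open>Every notion is defined for a base point in the first argument of the cost; the
  counterparts with a base point in the second one are obtained by passing \<open>flip c\<close> and
  exchanging the two domains.\<close>

definition flip :: "('a \<Rightarrow> 'b \<Rightarrow> real) \<Rightarrow> 'b \<Rightarrow> 'a \<Rightarrow> real" where
  "flip c = (\<lambda>y x. c x y)"

text \<open>\<open>covec M c x y\<close> is \<open>-Dc(x,y)\<close> in \<open>T\<^sup>*\<^sub>xM\<close>.\<close>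

definition covec :: "('a, 'n::finite) riem \<Rightarrow> ('a \<Rightarrow> 'b \<Rightarrow> real) \<Rightarrow> 'a \<Rightarrow> 'b \<Rightarrow> real ^ 'n" where
  "covec M c x y = (\<chi> i. - chart_pd (chart_at M x) i (\<lambda>z. c z y) x)"

definition c_exp :: "('a, 'n::finite) riem \<Rightarrow> ('a \<Rightarrow> 'b \<Rightarrow> real) \<Rightarrow> 'b set \<Rightarrow> 'a \<Rightarrow> real ^ 'n \<Rightarrow> 'b" where
  "c_exp M c \<Omega>' x p = (THE y. y \<in> \<Omega>' \<and> covec M c x y = p)"

definition c_segment :: "('a, 'n::finite) riem \<Rightarrow> ('a \<Rightarrow> 'b \<Rightarrow> real) \<Rightarrow> 'b set \<Rightarrow> 'a \<Rightarrow>
    'b \<Rightarrow> 'b \<Rightarrow> real \<Rightarrow> 'b" where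
  "c_segment M c \<Omega>' x y0 y1 t =
     c_exp M c \<Omega>' x ((1 - t) *\<^sub>R covec M c x y0 + t *\<^sub>R covec M c x y1)"

definition c_convex_wrt :: "('a, 'n::finite) riem \<Rightarrow> ('a \<Rightarrow> 'b \<Rightarrow> real) \<Rightarrow> 'b set \<Rightarrow> 'a \<Rightarrow> bool" where
  "c_convex_wrt M c B x \<longleftrightarrow> convex (covec M c x ` B)"

definition Twist :: "('a, 'n::finite) riem \<Rightarrow> ('b, 'n) riem \<Rightarrow> 'a set \<Rightarrow> 'b set \<Rightarrow>
    ('a \<Rightarrow> 'b \<Rightarrow> real) \<Rightarrow> bool" where
  "Twist M M' \<Omega> \<Omega>' c \<longleftrightarrow> (\<forall>x\<in>\<Omega>. inj_on (covec M c x) \<Omega>') \<and>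
     (\<forall>y\<in>\<Omega>'. inj_on (covec M' (flip c) y) \<Omega>)"

text \<open>\<open>X'\<close> is the support of the target density.\<close>

definition DomConv :: "('a, 'n::finite) riem \<Rightarrow> ('b::topological_space, 'n) riem \<Rightarrow> 'a set \<Rightarrow>
    'b set \<Rightarrow> 'b set \<Rightarrow> ('a \<Rightarrow> 'b \<Rightarrow> real) \<Rightarrow> bool" where
  "DomConv M M' \<Omega> \<Omega>' X' c \<longleftrightarrow>
     (\<forall>y\<in>\<Omega>'. c_convex_wrt M' (flip c) \<Omega> y) \<and>
     (\<forall>x\<in>\<Omega>. c_convex_wrt M c \<Omega>' x) \<and>
     (\<forall>x\<in>\<Omega>. c_convex_wrt M c X' x) \<and>
     compact X' \<and> X' \<subseteq> interior \<Omega>'"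

definition QQConv :: "('a, 'n::finite) riem \<Rightarrow> ('b, 'n) riem \<Rightarrow> 'a set \<Rightarrow> 'b set \<Rightarrow>
    ('a \<Rightarrow> 'b \<Rightarrow> real) \<Rightarrow> real \<Rightarrow> bool" where
  "QQConv M M' \<Omega> \<Omega>' c M0 \<longleftrightarrow>
     (\<forall>x\<in>\<Omega>. \<forall>x0\<in>\<Omega>. \<forall>x1\<in>\<Omega>. \<forall>y\<in>\<Omega>'. \<forall>y0\<in>\<Omega>'. \<forall>y1\<in>\<Omega>'. \<forall>s\<in>{0..1}. \<forall>t\<in>{0..1}.
        (let yt = c_segment M c \<Omega>' x0 y0 y1 t in
           - c x yt + c x y0 - (- c x0 yt + c x0 y0)
             \<le> M0 * t * max 0 (- c x y1 + c x y0 - (- c x0 y1 + c x0 y0))) \<and>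
        (let xs = c_segment M' (flip c) \<Omega> y0 x0 x1 s in
           - c xs y + c x0 y - (- c xs y0 + c x0 y0)
             \<le> M0 * s * max 0 (- c x1 y + c x0 y - (- c x1 y0 + c x0 y0))))"


subsection \<open>c-convex functions\<close>

definition c_function :: "('a \<Rightarrow> 'b \<Rightarrow> real) \<Rightarrow> 'a set \<Rightarrow> 'b \<Rightarrow> ('a \<Rightarrow> real) \<Rightarrow> bool" where
  "c_function c \<Omega> y m \<longleftrightarrow> (\<exists>l::real. \<forall>x\<in>\<Omega>. m x = - c x y + l)"

definition supporting :: "'a set \<Rightarrow> ('a \<Rightarrow> real) \<Rightarrow> ('a \<Rightarrow> real) \<Rightarrow> 'a \<Rightarrow> bool" where
  "supporting \<Omega> m u x0 \<longleftrightarrow> m x0 = u x0 \<and> (\<forall>x\<in>\<Omega>. m x \<le> u x)"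

definition c_convex_function ::
  "('a \<Rightarrow> 'b \<Rightarrow> real) \<Rightarrow> 'a set \<Rightarrow> 'b set \<Rightarrow> ('a \<Rightarrow> real) \<Rightarrow> bool" where
  "c_convex_function c \<Omega> \<Omega>' u \<longleftrightarrow>
     (\<forall>x0\<in>\<Omega>. \<exists>y\<in>\<Omega>'. \<exists>m. c_function c \<Omega> y m \<and> supporting \<Omega> m u x0)"

definition c_subdifferential ::
  "('a \<Rightarrow> 'b \<Rightarrow> real) \<Rightarrow> 'a set \<Rightarrow> 'b set \<Rightarrow> ('a \<Rightarrow> real) \<Rightarrow> 'a \<Rightarrow> 'b set" where
  "c_subdifferential c \<Omega> \<Omega>' u x =
     {y\<in>\<Omega>'. \<exists>m. c_function c \<Omega> y m \<and> supporting \<Omega> m u x}"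


subsection \<open>Center of mass and dilation\<close>

definition ellipsoid :: "real ^ 'n \<Rightarrow> real ^ 'n ^ 'n \<Rightarrow> (real ^ 'n::finite) set" where
  "ellipsoid p L = (\<lambda>v. p + L *v v) ` cball 0 1"

text \<open>Ellipsoids are closed, so for a convex set that is not closed the inner inclusion has to be
  read up to the boundary (for an open interval, the closed John ellipsoid is its closure).\<close>

definition is_center_of_mass :: "(real ^ 'n::finite) set \<Rightarrow> real ^ 'n \<Rightarrow> bool" where
  "is_center_of_mass S p \<longleftrightarrow> (\<exists>L. invertible L \<and>
     ellipsoid p L \<subseteq> closure S \<and>
     S \<subseteq> ellipsoid p (real CARD('n) *\<^sub>R L) \<and>
     (\<forall>q L'. invertible L' \<and> S \<subseteq> ellipsoid q L' \<longrightarrow>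
        measure lebesgue (ellipsoid p (real CARD('n) *\<^sub>R L)) \<le> measure lebesgue (ellipsoid q L')))"

definition dilated_covecs :: "('b, 'n::finite) riem \<Rightarrow> ('a \<Rightarrow> 'b \<Rightarrow> real) \<Rightarrow> 'b \<Rightarrow> real ^ 'n \<Rightarrow>
    real \<Rightarrow> 'a set \<Rightarrow> (real ^ 'n) set" where
  "dilated_covecs M' c y p \<kappa> A = (\<lambda>q. p + \<kappa> *\<^sub>R (q - p)) ` (covec M' (flip c) y ` A)"

definition c_dilation :: "('b, 'n::finite) riem \<Rightarrow> ('a \<Rightarrow> 'b \<Rightarrow> real) \<Rightarrow> 'a set \<Rightarrow> 'b \<Rightarrow>
    real ^ 'n \<Rightarrow> real \<Rightarrow> 'a set \<Rightarrow> 'a set" where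
  "c_dilation M' c \<Omega> y p \<kappa> A = c_exp M' (flip c) \<Omega> y ` dilated_covecs M' c y p \<kappa> A"

end

theory Submission
  imports Defs
begin

text \<open>Let \<open>q = -D'c(\<sqdot>,y)\<close> be the covector coordinate on \<open>\<Omega>\<close> at the focus \<open>y\<close> of \<open>m\<close>, let
\<open>h\<close> be the supremum of \<open>m - u\<close> over \<open>S\<close>, which may be taken finite, and let \<open>xc\<close> be the
point of \<open>A\<close> whose covector is the center of mass \<open>p\<close> of \<open>q(A)\<close>. The theorem rests on a
polarity: in suitable affine coordinates the covectors at \<open>xc\<close> of the points of \<open>\<partial>\<^sub>cu(A)\<close> lie
in \<open>h\<close> times the polar body of \<open>q(A) - p\<close>, and the volumes of a convex body and of its polar
with respect to the center of mass have a bounded product.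

For the confinement, let \<open>y1 \<in> \<partial>\<^sub>cu(x0)\<close> with \<open>x0 \<in> A\<close>, and put \<open>f = -c(\<sqdot>,y1) + c(\<sqdot>,y)\<close>. Since
the \<open>c\<close>-function supporting \<open>u\<close> at \<open>x0\<close> is below \<open>m\<close> on \<open>S\<close>, one has \<open>f - f(x0) \<le> h\<close> on \<open>S\<close>
(\<open>c_subdifferential_gap_le\<close>). This compares with the base point \<open>x0\<close>, which varies; the factor
\<open>2 M0\<close> of the dilation makes it possible to pass to the fixed base point \<open>xc\<close>, at the price of
\<open>2 h\<close> instead of \<open>h\<close> (\<open>QQConv_gap_le_of_dilation\<close>). Quantitative quasi-convexity along
\<open>c\<close>-segments that start at \<open>xc\<close>, differentiated at the start, turns the bound on \<open>f\<close> into a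
bound on its gradient in the \<open>q\<close> coordinate, tested on \<open>q(A) - p\<close> (\<open>QQConv_gradient_le\<close>,
\<open>c_subdifferential_covec_in_polar_ball\<close>). This gradient is a linear image of
\<open>-Dc(xc,y1) + Dc(xc,y)\<close>.

For the volumes, the John ellipsoid of \<open>q(A)\<close> replaces the body: \<open>q(A)\<close> is contained in the
ellipsoid dilated by the dimension, and the polar body is contained in the polar of the ellipsoid.
The determinants of the two are inverse to each other up to the determinant of the mixed second
derivative of the cost at \<open>(xc,y)\<close>. Finally the covector maps at \<open>y\<close> and at \<open>xc\<close> distort volumes
by bounded factors (\<open>riemannian_volume_preimage_le\<close>): both are injective by the twist
condition, and their Jacobians are mixed second derivatives of the cost, which are bounded above
and below. All constants are powers of \<open>K\<close> and constants of the dimension, so the resulting \<open>C\<close>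
is independent of \<open>c\<close>, \<open>u\<close>, \<open>m\<close> and \<open>A\<close>.\<close>

section \<open>Change of variables over an arbitrary finite index type\<close>

text \<open>Arguments by row reduction order the coordinates, and so the change-of-variables theorem
concerns a well-ordered index type. The type \<open>'n slot\<close> is a well-ordered copy of the index type \<open>'n\<close>: relabelling the coordinates
along a bijection preserves Lebesgue measure and determinants, so that the Jacobian inequality
passes from \<open>'n slot\<close> to \<open>'n\<close>.\<close>

typedef 'n slot = "{..<CARD('n::finite)}"
  by (rule exI[of _ 0]) simp

instance slot :: (finite) finite
proof
  show "finite (UNIV :: 'a slot set)"
    by (metis finite_imageI finite_lessThan type_definition.Abs_image type_definition_slot)
qed

instantiation slot :: (finite) linorder
begin

definition less_eq_slot :: "'a slot \<Rightarrow> 'a slot \<Rightarrow> bool" where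
  "less_eq_slot i j \<longleftrightarrow> Rep_slot i \<le> Rep_slot j"

definition less_slot :: "'a slot \<Rightarrow> 'a slot \<Rightarrow> bool" where
  "less_slot i j \<longleftrightarrow> Rep_slot i < Rep_slot j"

instance
  by standard (auto simp: less_eq_slot_def less_slot_def Rep_slot_inject)

end

instance slot :: (finite) wellorder
proof
  fix P :: "'a slot \<Rightarrow> bool" and a
  assume step: "\<And>x. (\<And>y. y < x \<Longrightarrow> P y) \<Longrightarrow> P x"
  show "P a"
    by (induction a rule: measure_induct_rule[of Rep_slot]) (auto intro: step simp: less_slot_def)
qed

lemma bij_slot_exists: "\<exists>\<beta> :: 'n::finite slot \<Rightarrow> 'n. bij \<beta>"
proof -
  have "card (UNIV :: 'n slot set) = CARD('n)"
    by (simp add: type_definition.card[OF type_definition_slot])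
  then show ?thesis
    by (metis finite_class.finite_UNIV finite_same_card_bij)
qed

text \<open>Conjugation with the bijection \<open>\<beta>\<close> matches the permutations in the two Leibniz expansions and
preserves signs.\<close>

lemma det_reindex:
  fixes \<beta> :: "'m::finite \<Rightarrow> 'n::finite" and A :: "'a::comm_ring_1 ^ 'n ^ 'n"
  assumes "bij \<beta>"
  shows "det (\<chi> i j. A $ \<beta> i $ \<beta> j) = det A"
proof -
  have inj: "inj \<beta>" and surj: "surj \<beta>"
    using assms by (auto simp: bij_def)
  have bij': "bij (inv \<beta>)"
    using assms by (rule bij_imp_bij_inv)
  have perm: "map_permutation UNIV \<beta> p permutes UNIV" if "p permutes UNIV" for p
    using map_permutation_permutes[of \<beta> UNIV UNIV p] that assms by (simp add: bij_betw_def bij_def)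
  have perm': "map_permutation UNIV (inv \<beta>) p permutes UNIV" if "p permutes UNIV" for p
    using map_permutation_permutes[of "inv \<beta>" UNIV UNIV p] that bij' by (simp add: bij_betw_def bij_def)
  have prod: "(\<Prod>k\<in>UNIV. A $ k $ map_permutation UNIV \<beta> p k) = (\<Prod>i\<in>UNIV. A $ \<beta> i $ \<beta> (p i))"
    if "p permutes UNIV" for p
  proof -
    have "(\<Prod>k\<in>UNIV. A $ k $ map_permutation UNIV \<beta> p k) 
        = (\<Prod>i\<in>UNIV. A $ \<beta> i $ map_permutation UNIV \<beta> p (\<beta> i))"
      using assms by (rule prod.reindex_bij_betw[symmetric])
    then show ?thesis
      using inj by (simp add: map_permutation_apply)
  qed
  have "det A = (\<Sum>p\<in>{p. p permutes (UNIV::'m set)}. of_int (sign p) * (\<Prod>i\<in>UNIV. A $ \<beta> i $ \<beta> (p i)))"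
    unfolding det_def
  proof (rule sum.reindex_bij_witness[where i = "map_permutation UNIV \<beta>" and j = "map_permutation UNIV (inv \<beta>)"], goal_cases)
    case (1 q)
    then show ?case
      using map_permutation_compose_inv[of "inv \<beta>" UNIV UNIV q \<beta>] bij' surj
      by (simp add: surj_f_inv_f)
  next
    case (2 q)
    then show ?case by (simp add: perm')
  next
    case (3 p)
    then show ?case
      using map_permutation_compose_inv[of \<beta> UNIV UNIV p "inv \<beta>"] assms inj by simp
  next
    case (4 p)
    then show ?case by (simp add: perm)
  next
    case (5 q)
    have eq: "map_permutation UNIV \<beta> (map_permutation UNIV (inv \<beta>) q) = q"
      using map_permutation_compose_inv[of "inv \<beta>" UNIV UNIV q \<beta>] bij' surj 5
      by (simp add: surj_f_inv_f)
    have "sign (map_permutation UNIV (inv \<beta>) q) = sign q"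
      using sign_map_permutation[of "inv \<beta>" UNIV q] bij' 5 by (simp add: bij_def)
    with prod[of "map_permutation UNIV (inv \<beta>) q"] perm' 5 eq show ?case by simp
  qed
  then show ?thesis
    by (simp add: det_def)
qed

definition reindex :: "('m \<Rightarrow> 'n) \<Rightarrow> 'a ^ 'n::finite \<Rightarrow> 'a ^ 'm::finite" where
  "reindex \<beta> v = (\<chi> i. v $ \<beta> i)"

lemma reindex_inv [simp]:
  assumes "bij \<beta>"
  shows "reindex (inv \<beta>) (reindex \<beta> v) = v" and "reindex \<beta> (reindex (inv \<beta>) w) = w"
  using assms by (auto simp: reindex_def vec_eq_iff bij_def surj_f_inv_f)

lemma linear_reindex: "linear (reindex \<beta> :: real ^ 'n::finite \<Rightarrow> real ^ 'm::finite)"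
  by (rule linearI) (auto simp: reindex_def vec_eq_iff)

lemma emeasure_lborel_box_cart:
  fixes l u :: "real ^ 'n::finite"
  assumes "\<And>i. l $ i \<le> u $ i"
  shows "emeasure lborel (box l u) = ennreal (\<Prod>i\<in>UNIV. u $ i - l $ i)"
proof -
  have le: "\<And>b. b \<in> Basis \<Longrightarrow> l \<bullet> b \<le> u \<bullet> b"
    using assms by (auto simp: Basis_vec_def inner_axis)
  have "emeasure lborel (box l u) = emeasure lborel (cbox l u)"
    using le by simp
  also have "\<dots> = ennreal (measure lborel (cbox l u))"
    by (metis emeasure_eq_ennreal_measure emeasure_lborel_cbox_finite less_irrefl infinity_ennreal_def)
  also have "measure lborel (cbox l u) = (\<Prod>i\<in>UNIV. u $ i - l $ i)"
    using assms by (intro content_cbox_cart) (simp add: interval_ne_empty_cart)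
  finally show ?thesis .
qed

text \<open>The preimage of a box is the box with relabelled sides, and the product of the side lengths does
not depend on their order.\<close>

lemma distr_reindex_lborel:
  fixes \<beta> :: "'m::finite \<Rightarrow> 'n::finite"
  assumes "bij \<beta>"
  shows "distr lborel borel (reindex \<beta> :: real ^ 'n \<Rightarrow> real ^ 'm) = lborel"
proof (rule lborel_eqI[symmetric])
  have m: "(reindex \<beta> :: real ^ 'n \<Rightarrow> real ^ 'm) \<in> borel_measurable borel"
    by (intro borel_measurable_continuous_onI linear_continuous_on linear_conv_bounded_linear[THEN iffD1] linear_reindex)
  fix l u :: "real ^ 'm"
  assume le: "\<And>b. b \<in> Basis \<Longrightarrow> l \<bullet> b \<le> u \<bullet> b"
  have le': "l $ i \<le> u $ i" for i
    using le[of "axis i 1"] by (simp add: inner_axis)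
  have pre: "reindex \<beta> -` box l u = box (reindex (inv \<beta>) l) (reindex (inv \<beta>) u)"
  proof (intro set_eqI)
    fix x :: "real ^ 'n"
    have "(\<forall>i. l $ i < x $ \<beta> i \<and> x $ \<beta> i < u $ i) \<longleftrightarrow> (\<forall>k. l $ inv \<beta> k < x $ k \<and> x $ k < u $ inv \<beta> k)"
      using assms by (metis bij_inv_eq_iff)
    then show "x \<in> reindex \<beta> -` box l u \<longleftrightarrow> x \<in> box (reindex (inv \<beta>) l) (reindex (inv \<beta>) u)"
      by (simp add: mem_box_cart reindex_def)
  qed
  have "emeasure (distr lborel borel (reindex \<beta>)) (box l u) = emeasure lborel (box (reindex (inv \<beta>) l) (reindex (inv \<beta>) u))"
    using m by (subst emeasure_distr) (auto simp: pre)
  also have "\<dots> = ennreal (\<Prod>k\<in>UNIV. u $ inv \<beta> k - l $ inv \<beta> k)"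
    using le' by (subst emeasure_lborel_box_cart) (auto simp: reindex_def)
  also have "(\<Prod>k\<in>UNIV. u $ inv \<beta> k - l $ inv \<beta> k) = (\<Prod>i\<in>UNIV. u $ i - l $ i)"
    by (rule prod.reindex_bij_betw[OF bij_imp_bij_inv[OF assms]])
  also have "ennreal \<dots> = emeasure lborel (box l u)"
    using le' by (simp add: emeasure_lborel_box_cart)
  also have "\<dots> = (\<Prod>b\<in>Basis. (u - l) \<bullet> b)"
    using le by (rule emeasure_lborel_box)
  finally show "emeasure (distr lborel borel (reindex \<beta>)) (box l u) = (\<Prod>b\<in>Basis. (u - l) \<bullet> b)" .
qed simp

text \<open>For an image of finite measure this is the (exact) change-of-variables formula; otherwise the
right-hand side is infinite. No integrability of the Jacobian has to be checked in this way.\<close>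

lemma nn_integral_jacobian_le_wellorder:
  fixes F :: "real ^ 'm::{finite,wellorder} \<Rightarrow> real ^ 'm::_"
  assumes S: "S \<in> sets lebesgue"
    and der: "\<And>x. x \<in> S \<Longrightarrow> (F has_derivative F' x) (at x within S)"
    and inj: "inj_on F S"
  shows "(\<integral>\<^sup>+x. ennreal \<bar>det (matrix (F' x))\<bar> * indicator S x \<partial>lborel) \<le> emeasure lebesgue (F ` S)"
proof (cases "F ` S \<in> lmeasurable")
  case True
  then have "((\<lambda>x. \<bar>det (matrix (F' x))\<bar>) has_integral measure lebesgue (F ` S)) S"
    using has_measure_differentiable_image[OF S der inj] by blast
  then have "(\<integral>\<^sup>+x. ennreal \<bar>det (matrix (F' x))\<bar> * indicator S x \<partial>lborel) = ennreal (measure lebesgue (F ` S))"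
    by (rule nn_integral_has_integral_lebesgue'[rotated]) simp
  with True show ?thesis
    by (simp add: emeasure_eq_measure2)
next
  case False
  have "F ` S \<in> sets lebesgue"
    using S der by (intro differentiable_image_in_sets_lebesgue) (auto simp: differentiable_on_def differentiable_def)
  with False have "emeasure lebesgue (F ` S) = \<infinity>"
    by (metis fmeasurableI infinity_ennreal_def top.not_eq_extremum)
  then show ?thesis by simp
qed

text \<open>The previous inequality for \<open>r \<circ> F \<circ> r\<inverse>\<close>, where \<open>r\<close> relabels the coordinates.
Continuity of the Jacobian serves to make the integrand Borel, so that the integral can be pushed
forward along \<open>r\<close>.\<close>

lemma nn_integral_jacobian_le:
  fixes F :: "real ^ 'n::finite \<Rightarrow> real ^ 'n"
  assumes S: "S \<in> sets borel"
    and der: "\<And>x. x \<in> S \<Longrightarrow> (F has_derivative F' x) (at x within S)"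
    and inj: "inj_on F S"
    and cont: "continuous_on S (\<lambda>x. det (matrix (F' x)))"
    and FS: "F ` S \<in> sets borel"
  shows "(\<integral>\<^sup>+x. ennreal \<bar>det (matrix (F' x))\<bar> * indicator S x \<partial>lborel) \<le> emeasure lborel (F ` S)"
proof -
  obtain \<beta> :: "'n slot \<Rightarrow> 'n" where \<beta>: "bij \<beta>"
    using bij_slot_exists by blast
  define r :: "real ^ 'n \<Rightarrow> real ^ 'n slot" where "r = reindex \<beta>"
  define r' :: "real ^ 'n slot \<Rightarrow> real ^ 'n" where "r' = reindex (inv \<beta>)"
  have rr': "r (r' w) = w" and r'r: "r' (r v) = v" for v w
    using \<beta> by (simp_all add: r_def r'_def)
  have bl: "bounded_linear r" "bounded_linear r'"
    using linear_reindex linear_conv_bounded_linear unfolding r_def r'_def by blast+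
  then have cr: "continuous_on UNIV r" "continuous_on UNIV r'"
    by (auto intro: linear_continuous_on)
  then have mr [measurable]: "r \<in> borel_measurable borel" "r' \<in> borel_measurable borel"
    by (auto intro: borel_measurable_continuous_onI)
  have img: "r ` T = r' -` T" for T
    using rr' r'r by (auto simp: image_iff) metis
  have img_borel: "r ` T \<in> sets borel" if "T \<in> sets borel" for T
    using measurable_sets_borel[OF mr(2) that] by (simp add: img)
  have lb: "distr lborel borel r = lborel"
    using distr_reindex_lborel[OF \<beta>] by (simp add: r_def)
  have em: "emeasure lborel (r ` T) = emeasure lborel T" if "T \<in> sets borel" for T
  proof -
    have "emeasure lborel (r ` T) = emeasure (distr lborel borel r) (r ` T)"
      by (simp add: lb)
    also have "\<dots> = emeasure lborel (r -` (r ` T))"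
      using mr img_borel[OF that] by (subst emeasure_distr) auto
    also have "r -` (r ` T) = T"
      using r'r by (auto simp: image_iff) metis
    finally show ?thesis .
  qed
  define G where "G = r \<circ> F \<circ> r'"
  define G' where "G' = (\<lambda>w. r \<circ> F' (r' w) \<circ> r')"
  have det: "det (matrix (G' w)) = det (matrix (F' (r' w)))" for w
  proof -
    have "matrix (G' w) = (\<chi> i j. matrix (F' (r' w)) $ \<beta> i $ \<beta> j)"
    proof -
      have ax: "r' (axis j 1) = axis (\<beta> j) 1" for j
        using \<beta> by (auto simp: r'_def reindex_def axis_def vec_eq_iff) (metis bij_inv_eq_iff)+
      show ?thesis
        unfolding matrix_def G'_def o_def ax by (simp add: r_def reindex_def)
    qed
    then show ?thesis
      using det_reindex[OF \<beta>] by metis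
  qed
  have derG: "(G has_derivative G' w) (at w within r ` S)" if "w \<in> r ` S" for w
  proof -
    have im: "r' ` (r ` S) = S"
      using r'r by (force simp: image_image)
    have w: "r' w \<in> S"
      using that im by blast
    have 1: "(r' has_derivative r') (at w within r ` S)"
      by (rule bounded_linear_imp_has_derivative[OF bl(2)])
    have 2: "(F has_derivative F' (r' w)) (at (r' w) within r' ` (r ` S))"
      using der[OF w] by (simp add: im)
    have 3: "(r has_derivative r) (at (F (r' w)) within F ` (r' ` (r ` S)))"
      by (rule bounded_linear_imp_has_derivative[OF bl(1)])
    show ?thesis
      using diff_chain_within[OF 1 diff_chain_within[OF 2 3]] by (simp add: G_def G'_def o_def)
  qed
  have injG: "inj_on G (r ` S)"
  proof (rule inj_onI)
    fix v w assume vw: "v \<in> r ` S" "w \<in> r ` S" and "G v = G w"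
    then have "r' (r (F (r' v))) = r' (r (F (r' w)))"
      by (simp add: G_def)
    then have "F (r' v) = F (r' w)"
      by (simp only: r'r)
    moreover have "r' v \<in> S" "r' w \<in> S"
      using vw by (auto simp: r'r)
    ultimately have "r' v = r' w"
      by (rule inj_onD[OF inj])
    then have "r (r' v) = r (r' w)"
      by (rule arg_cong)
    then show "v = w"
      by (simp only: rr')
  qed
  have GS: "G ` (r ` S) = r ` (F ` S)"
    by (simp add: G_def image_image r'r)
  have meas: "(\<lambda>x. ennreal \<bar>det (matrix (F' x))\<bar> * indicator S x) \<in> borel_measurable borel"
  proof -
    have "(\<lambda>x. indicator S x *\<^sub>R \<bar>det (matrix (F' x))\<bar>) \<in> borel_measurable borel"
      by (intro borel_measurable_continuous_on_indicator S continuous_intros cont)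
    then have "(\<lambda>x. ennreal (indicator S x *\<^sub>R \<bar>det (matrix (F' x))\<bar>)) \<in> borel_measurable borel"
      by simp
    then show ?thesis
      by (rule back_subst[where P = "\<lambda>f. f \<in> borel_measurable borel"]) (auto simp: indicator_def)
  qed
  have "(\<integral>\<^sup>+x. ennreal \<bar>det (matrix (F' x))\<bar> * indicator S x \<partial>lborel)
      = (\<integral>\<^sup>+x. ennreal \<bar>det (matrix (F' (r' (r x))))\<bar> * indicator S (r' (r x)) \<partial>lborel)"
    by (simp add: r'r)
  also have "\<dots> = (\<integral>\<^sup>+w. ennreal \<bar>det (matrix (F' (r' w)))\<bar> * indicator S (r' w) \<partial>distr lborel borel r)"
    using measurable_compose[OF mr(2) meas] by (subst nn_integral_distr) auto
  also have "\<dots> = (\<integral>\<^sup>+w. ennreal \<bar>det (matrix (G' w))\<bar> * indicator (r ` S) w \<partial>lborel)"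
    by (simp add: lb det img indicator_def vimage_def)
  also have "\<dots> \<le> emeasure lebesgue (G ` (r ` S))"
    using img_borel[OF S] by (intro nn_integral_jacobian_le_wellorder derG injG) auto
  also have "\<dots> = emeasure lborel (F ` S)"
    using em[OF FS] img_borel[OF FS] by (simp add: GS)
  finally show ?thesis .
qed

section \<open>Determinants, images of balls and mixed partial derivatives\<close>

lemma matrix_inv_mult:
  assumes "invertible L"
  shows "L ** matrix_inv L = mat 1" and "matrix_inv L ** L = mat 1"
  using someI_ex[OF assms[unfolded invertible_def]] by (simp_all add: matrix_inv_def)

text \<open>The Jacobian inequality bounds the measure of a domain by that of its image, so it is
applied to the inverse affine map, which sends the ellipsoid back to the ball.\<close>

lemma emeasure_affine_image_cball_le:
  fixes L :: "real ^ 'n::finite ^ 'n"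
  assumes L: "invertible L" and r: "0 \<le> r"
  shows "emeasure lborel ((\<lambda>v. p + L *v v) ` cball 0 r)
           \<le> ennreal (\<bar>det L\<bar> * unit_ball_vol (CARD('n)) * r ^ CARD('n))"
proof -
  define T where "T = (\<lambda>v. p + L *v v) ` cball 0 r"
  define L' where "L' = matrix_inv L"
  have LL': "L' ** L = mat 1" "L ** L' = mat 1"
    using matrix_inv_mult[OF L] by (simp_all add: L'_def)
  have detL: "det L * det L' = 1"
    by (metis LL'(2) det_I det_mul)
  have img: "(\<lambda>w. L' *v (w - p)) ` T = cball 0 r"
    by (simp add: T_def image_image matrix_vector_mul_assoc LL')
  have T: "T \<in> sets borel"
    unfolding T_def
    by (intro borel_compact compact_continuous_image continuous_intros
        linear_continuous_on matrix_vector_mul_bounded_linear) simp_all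
  have "(\<integral>\<^sup>+x. ennreal \<bar>det (matrix ((*v) L'))\<bar> * indicator T x \<partial>lborel)
      \<le> emeasure lborel ((\<lambda>w. L' *v (w - p)) ` T)"
  proof (rule nn_integral_jacobian_le[OF T])
    have "((\<lambda>w. L' *v (w - p)) has_derivative (\<lambda>v. L' *v (v - 0))) (at x within T)" for x
      by (intro bounded_linear.has_derivative[OF matrix_vector_mul_bounded_linear] derivative_intros)
    then show "((\<lambda>w. L' *v (w - p)) has_derivative (*v) L') (at x within T)" for x
      by simp
    show "inj_on (\<lambda>w. L' *v (w - p)) T"
    proof (rule inj_onI)
      fix v w assume "L' *v (v - p) = L' *v (w - p)"
      then have "L *v (L' *v (v - p)) = L *v (L' *v (w - p))" by simp
      then show "v = w" by (simp add: matrix_vector_mul_assoc LL')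
    qed
  qed (auto simp: img)
  then have le: "ennreal \<bar>det L'\<bar> * emeasure lborel T \<le> emeasure lborel (cball 0 r :: (real ^ 'n) set)"
    using T by (simp add: img nn_integral_cmult_indicator)
  have "emeasure lborel T = ennreal (\<bar>det L\<bar> * \<bar>det L'\<bar>) * emeasure lborel T"
    using detL by (simp add: abs_mult[symmetric])
  also have "\<dots> = ennreal \<bar>det L\<bar> * (ennreal \<bar>det L'\<bar> * emeasure lborel T)"
    by (simp add: ennreal_mult mult.assoc)
  also have "\<dots> \<le> ennreal \<bar>det L\<bar> * emeasure lborel (cball 0 r :: (real ^ 'n) set)"
    using le by (rule mult_left_mono) simp
  also have "\<dots> = ennreal (\<bar>det L\<bar> * unit_ball_vol (CARD('n)) * r ^ CARD('n))"
    using r by (simp add: emeasure_cball ennreal_mult' [symmetric] mult.assoc)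
  finally show ?thesis by (simp add: T_def)
qed

text \<open>Along the segment from the identity to \<open>G\<close> all matrices are positive definite, hence regular, so
the determinant keeps the sign it has at the identity. In particular the Riemannian density
\<open>sqrt (det g)\<close> is positive.\<close>

lemma det_pos_if_positive_definite:
  fixes G :: "real ^ 'n::finite ^ 'n"
  assumes pos: "\<And>v. v \<noteq> 0 \<Longrightarrow> v \<bullet> (G *v v) > 0"
  shows "det G > 0"
proof (rule ccontr)
  define H where "H = (\<lambda>t::real. (1 - t) *\<^sub>R mat 1 + t *\<^sub>R G)"
  assume "\<not> det G > 0"
  then have "det (H 1) \<le> 0" by (simp add: H_def)
  moreover have "0 \<le> det (H 0)" by (simp add: H_def)
  moreover have "continuous_on {0..1} (\<lambda>t. det (H t))"
    unfolding H_def det_def by (intro continuous_intros)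
  ultimately obtain t where t: "0 \<le> t" "t \<le> 1" "det (H t) = 0"
    using IVT2'[of "\<lambda>t. det (H t)" 1 0 0] by auto
  then obtain v where v: "v \<noteq> 0" "H t *v v = 0"
    using invertible_det_nz[of "H t"] matrix_left_invertible_ker[of "H t"] invertible_left_inverse[of "H t"] by auto
  have "v \<bullet> (H t *v v) = (1 - t) * (v \<bullet> v) + t * (v \<bullet> (G *v v))"
    by (simp add: H_def matrix_vector_mult_add_rdistrib scaleR_matrix_vector_assoc[symmetric] inner_add_right)
  moreover have "\<dots> > 0"
  proof (cases "t = 0")
    case False
    with t v pos[of v] show ?thesis
      by (intro add_nonneg_pos) auto
  qed (use v in simp)
  ultimately show False using v by simp
qed

text \<open>Schwarz's theorem for two directions. Only the two mixed derivatives are assumed to exist, not the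
pure second ones, so the proof is the classical one: the second difference of \<open>f\<close> over a small
square equals \<open>h\<^sup>2\<close> times either mixed derivative at some point of the square.\<close>

lemma mixed_partials_commute:
  fixes f f1 f2 f12 f21 :: "real \<Rightarrow> real \<Rightarrow> real"
  assumes d: "d > 0"
    and f1: "\<And>s t. \<bar>s\<bar> < d \<Longrightarrow> \<bar>t\<bar> < d \<Longrightarrow> ((\<lambda>s. f s t) has_real_derivative f1 s t) (at s)"
    and f12: "\<And>s t. \<bar>s\<bar> < d \<Longrightarrow> \<bar>t\<bar> < d \<Longrightarrow> ((\<lambda>t. f1 s t) has_real_derivative f12 s t) (at t)"
    and f2: "\<And>s t. \<bar>s\<bar> < d \<Longrightarrow> \<bar>t\<bar> < d \<Longrightarrow> ((\<lambda>t. f s t) has_real_derivative f2 s t) (at t)"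
    and f21: "\<And>s t. \<bar>s\<bar> < d \<Longrightarrow> \<bar>t\<bar> < d \<Longrightarrow> ((\<lambda>s. f2 s t) has_real_derivative f21 s t) (at s)"
    and c12: "isCont (\<lambda>(s, t). f12 s t) (0, 0)" and c21: "isCont (\<lambda>(s, t). f21 s t) (0, 0)"
  shows "f12 0 0 = f21 0 0"
proof (rule ccontr)
  assume "f12 0 0 \<noteq> f21 0 0"
  define e where "e = \<bar>f12 0 0 - f21 0 0\<bar> / 2"
  have e: "e > 0" using \<open>f12 0 0 \<noteq> f21 0 0\<close> by (simp add: e_def)
  obtain d1 where d1: "d1 > 0" "\<And>z. dist z (0,0) < d1 \<Longrightarrow> dist ((\<lambda>(s, t). f12 s t) z) (f12 0 0) < e"
    using c12 e unfolding continuous_at_eps_delta by fastforce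
  obtain d2 where d2: "d2 > 0" "\<And>z. dist z (0,0) < d2 \<Longrightarrow> dist ((\<lambda>(s, t). f21 s t) z) (f21 0 0) < e"
    using c21 e unfolding continuous_at_eps_delta by fastforce
  define h where "h = min d (min d1 d2) / 2"
  have h: "h > 0" "h < d" "2 * h \<le> d1" "2 * h \<le> d2"
    using d d1 d2 by (auto simp: h_def)
  have near: "dist (s, t) (0, 0) < 2 * h" if "0 < s" "s < h" "0 < t" "t < h" for s t :: real
  proof -
    have "dist (s, t) (0, 0) \<le> \<bar>s\<bar> + \<bar>t\<bar>"
      by (simp add: dist_Pair_Pair dist_real_def sqrt_sum_squares_le_sum_abs)
    with that show ?thesis by simp
  qed
  define D where "D = f h h - f h 0 - f 0 h + f 0 0"
  obtain s t where st: "0 < s" "s < h" "0 < t" "t < h" "D = h * h * f12 s t"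
  proof -
    have "((\<lambda>s. f s h - f s 0) has_real_derivative f1 s h - f1 s 0) (at s)" if "0 \<le> s" "s \<le> h" for s
      using that h by (intro derivative_intros f1) auto
    then obtain s where s: "0 < s" "s < h" "D = h * (f1 s h - f1 s 0)"
      using MVT2[of 0 h "\<lambda>s. f s h - f s 0" "\<lambda>s. f1 s h - f1 s 0"] h by (auto simp: D_def)
    have "((\<lambda>t. f1 s t) has_real_derivative f12 s t) (at t)" if "0 \<le> t" "t \<le> h" for t
      using that h s by (intro f12) auto
    then obtain t where "0 < t" "t < h" "f1 s h - f1 s 0 = h * f12 s t"
      using MVT2[of 0 h "\<lambda>t. f1 s t" "\<lambda>t. f12 s t"] h by auto
    with s show ?thesis using that by (simp add: mult.assoc)
  qed
  obtain s' t' where st': "0 < s'" "s' < h" "0 < t'" "t' < h" "D = h * h * f21 s' t'"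
  proof -
    have "((\<lambda>t. f h t - f 0 t) has_real_derivative f2 h t - f2 0 t) (at t)" if "0 \<le> t" "t \<le> h" for t
      using that h by (intro derivative_intros f2) auto
    then obtain t where t: "0 < t" "t < h" "D = h * (f2 h t - f2 0 t)"
      using MVT2[of 0 h "\<lambda>t. f h t - f 0 t" "\<lambda>t. f2 h t - f2 0 t"] h by (auto simp: D_def)
    have "((\<lambda>s. f2 s t) has_real_derivative f21 s t) (at s)" if "0 \<le> s" "s \<le> h" for s
      using that h t by (intro f21) auto
    then obtain s where "0 < s" "s < h" "f2 h t - f2 0 t = h * f21 s t"
      using MVT2[of 0 h "\<lambda>s. f2 s t" "\<lambda>s. f21 s t"] h by auto
    with t show ?thesis using that by (simp add: mult.assoc)
  qed
  have "f12 s t = f21 s' t'"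
    using st(5) st'(5) h by simp
  moreover have "dist (f12 s t) (f12 0 0) < e"
    using d1(2)[of "(s, t)"] near[OF st(1-4)] h by simp
  moreover have "dist (f21 s' t') (f21 0 0) < e"
    using d2(2)[of "(s', t')"] near[OF st'(1-4)] h by simp
  ultimately have "\<bar>f12 0 0 - f21 0 0\<bar> < e + e"
    unfolding dist_real_def by linarith
  then show False
    by (simp add: e_def)
qed

section \<open>Comparing the Riemannian volume with Lebesgue measure\<close>

lemma homeomorphism_image_borel:
  assumes "homeomorphism X Y f g" "Y \<in> sets borel" "T \<subseteq> X" "T \<in> sets borel"
  shows "f ` T \<in> sets borel"
proof -
  have cont: "continuous_on Y g"
    using assms(1) by (rule homeomorphism_cont2)
  have "f ` T = g -` T \<inter> Y"
    using assms(1,3) unfolding homeomorphism_def by force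
  also have "\<dots> \<in> sets (restrict_space borel Y)"
    using measurable_sets[OF borel_measurable_continuous_on_restrict[OF cont] assms(4)]
    by (simp add: space_restrict_space)
  finally show ?thesis
    using assms(2) by (simp add: sets_restrict_space_iff)
qed

lemma countable_atlas:
  fixes N :: "('a::{t2_space,second_countable_topology}, 'n::finite) riem"
  assumes "riemannian_manifold N"
  obtains A :: "nat \<Rightarrow> ('a, 'n) chart" where "\<And>i. A i \<in> atlas N" "(\<Union>i. fst (A i)) = UNIV"
proof -
  have "openin (top_of_set UNIV) S" if "S \<in> fst ` atlas N" for S
    using that assms by (auto simp: riemannian_manifold_def is_chart_def)
  from Lindelof_openin[OF this] obtain \<F> where \<F>: "\<F> \<subseteq> fst ` atlas N" "countable \<F>" "\<Union>\<F> = \<Union>(fst ` atlas N)"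
    by blast
  have U: "\<Union>\<F> = UNIV"
    using \<F>(3) assms by (simp add: riemannian_manifold_def)
  then have ne: "\<F> \<noteq> {}" by auto
  have "\<exists>A\<in>atlas N. fst A = from_nat_into \<F> i" for i
    using from_nat_into[OF ne, of i] \<F>(1) by (metis image_iff subsetD)
  then obtain A where A: "\<And>i. A i \<in> atlas N" "\<And>i. fst (A i) = from_nat_into \<F> i"
    by metis
  moreover have "(\<Union>i. fst (A i)) = UNIV"
    using A(2) range_from_nat_into[OF ne \<F>(2)] U by simp
  ultimately show ?thesis using that by blast
qed

lemma homeomorphism_chart:
  assumes "is_chart A"
  shows "homeomorphism (fst A) (snd A ` fst A) (snd A) (chart_inv A)"
    and "open (fst A)" and "open (snd A ` fst A)"
    and "x \<in> fst A \<Longrightarrow> chart_inv A (snd A x) = x"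
  using assms by (auto simp: is_chart_def homeomorphism_def)

lemma open_chart_image:
  assumes A: "is_chart A" and W: "open W"
  shows "open (snd A ` (W \<inter> fst A))"
proof -
  have "openin (top_of_set (fst A)) (W \<inter> fst A)"
    using homeomorphism_chart(2)[OF A] W by (simp add: openin_open_eq open_Int)
  then have "openin (top_of_set (snd A ` fst A)) (snd A ` (W \<inter> fst A))"
    by (rule homeomorphism_imp_open_map[OF homeomorphism_chart(1)[OF A]])
  then show ?thesis
    using homeomorphism_chart(3)[OF A] by (simp add: openin_open_eq)
qed

lemma continuous_on_det:
  fixes J :: "'a::topological_space \<Rightarrow> real ^ 'n::finite ^ 'n"
  assumes "continuous_on S J"
  shows "continuous_on S (\<lambda>z. det (J z))"
proof -
  have "continuous_on S (\<lambda>z. J z $ i $ j)" for i j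
    using continuous_on_component[OF continuous_on_component[OF assms]] .
  then show ?thesis
    unfolding det_def by (intro continuous_on_sum continuous_on_mult continuous_on_prod continuous_on_const)
qed

text \<open>Inside one chart, the volume is the integral of \<open>sqrt (det g)\<close>, which the bound replaces by
\<open>\<kappa>\<close> times the Jacobian of \<open>G\<close>; the injectivity of \<open>G\<close> turns the integral of the Jacobian into
the measure of the image. By invariance of domain \<open>G\<close> is, in the chart, a homeomorphism onto an
open set, which makes the image of a Borel set Borel.\<close>

lemma riemannian_volume_chart_piece_le:
  fixes N :: "('a::{t2_space,second_countable_topology}, 'n::finite) riem"
    and G :: "'a \<Rightarrow> real ^ 'n"
  assumes N: "riemannian_manifold N" and \<nu>: "riemannian_volume N \<nu>"
    and B: "B \<in> atlas N" and W: "open W" and inj: "inj_on G W"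
    and D: "D \<in> sets borel" "D \<subseteq> W \<inter> fst B"
    and der: "\<And>y. y \<in> W \<inter> fst B \<Longrightarrow> ((G \<circ> chart_inv B) has_derivative (*v) (J y)) (at (snd B y))"
    and cont: "continuous_on (W \<inter> fst B) J"
    and bound: "\<And>y. y \<in> W \<inter> fst B \<Longrightarrow> sqrt (det (gmat N B y)) \<le> \<kappa> * \<bar>det (J y)\<bar>"
    and \<kappa>: "0 \<le> \<kappa>"
  shows "G ` D \<in> sets borel" and "emeasure \<nu> D \<le> ennreal \<kappa> * emeasure lborel (G ` D)"
proof -
  have ch: "is_chart B"
    using N B by (simp add: riemannian_manifold_def)
  note homB = homeomorphism_chart[OF ch]
  define U where "U = snd B ` (W \<inter> fst B)"
  define F where "F = G \<circ> chart_inv B"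
  define T where "T = snd B ` D"
  have U: "open U"
    unfolding U_def using ch W by (rule open_chart_image)
  have TU: "T \<subseteq> U"
    using D by (auto simp: T_def U_def)
  have inv: "chart_inv B z \<in> W \<inter> fst B" "snd B (chart_inv B z) = z" if "z \<in> U" for z
    using that homB(4) by (auto simp: U_def)
  have derF: "(F has_derivative (*v) (J (chart_inv B z))) (at z)" if "z \<in> U" for z
    using der[OF inv(1)[OF that]] inv(2)[OF that] by (simp add: F_def)
  have contF: "continuous_on U F"
    by (intro continuous_at_imp_continuous_on ballI has_derivative_continuous[OF derF])
  have injF: "inj_on F U"
  proof (rule inj_onI)
    fix z z' assume z: "z \<in> U" "z' \<in> U" and "F z = F z'"
    then have "chart_inv B z = chart_inv B z'"
      using inj_onD[OF inj] inv(1)[OF z(1)] inv(1)[OF z(2)] by (simp add: F_def)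
    then show "z = z'"
      by (metis inv(2)[OF z(1)] inv(2)[OF z(2)])
  qed
  have T: "T \<in> sets borel"
    unfolding T_def using D homB(3) by (intro homeomorphism_image_borel[OF homB(1) _ _ D(1)]) auto
  obtain h where h: "homeomorphism U (F ` U) F h"
    using invariance_of_domain_homeomorphism[OF U contF order_refl injF] .
  have "open (F ` U)"
    using contF U injF by (rule invariance_of_domain)
  then have FT: "F ` T \<in> sets borel"
    by (intro homeomorphism_image_borel[OF h _ TU T]) simp
  have FTD: "F ` T = G ` D"
  proof -
    have "F ` T = (\<lambda>y. G (chart_inv B (snd B y))) ` D"
      by (simp add: T_def F_def image_image)
    also have "\<dots> = G ` D"
      using D(2) by (intro image_cong) (auto simp: homB(4))
    finally show ?thesis .
  qed
  show "G ` D \<in> sets borel"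
    using FT by (simp add: FTD)
  have contJ: "continuous_on T (\<lambda>z. J (chart_inv B z))"
  proof (rule continuous_on_compose2[OF cont])
    show "continuous_on T (chart_inv B)"
      using TU by (intro continuous_on_subset[OF homeomorphism_cont2[OF homB(1)]]) (auto simp: U_def)
    show "chart_inv B ` T \<subseteq> W \<inter> fst B"
      using TU inv by auto
  qed
  have "emeasure \<nu> D = (\<integral>\<^sup>+ y. ennreal (sqrt (det (gmat N B (chart_inv B y)))) * indicator T y \<partial>lborel)"
  proof -
    have "\<forall>E\<in>sets borel. E \<subseteq> fst B \<longrightarrow> emeasure \<nu> E =
        (\<integral>\<^sup>+ y. ennreal (sqrt (det (gmat N B (chart_inv B y)))) * indicator (snd B ` E) y \<partial>lborel)"
      using \<nu> B by (simp add: riemannian_volume_def)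
    then show ?thesis
      using D by (simp add: T_def)
  qed
  also have "\<dots> \<le> (\<integral>\<^sup>+ y. ennreal \<kappa> * (ennreal \<bar>det (matrix ((*v) (J (chart_inv B y))))\<bar> * indicator T y) \<partial>lborel)"
  proof (rule nn_integral_mono)
    fix y
    show "ennreal (sqrt (det (gmat N B (chart_inv B y)))) * indicator T y
       \<le> ennreal \<kappa> * (ennreal \<bar>det (matrix ((*v) (J (chart_inv B y))))\<bar> * indicator T y)"
    proof (cases "y \<in> T")
      case True
      then have "sqrt (det (gmat N B (chart_inv B y))) \<le> \<kappa> * \<bar>det (J (chart_inv B y))\<bar>"
        using TU by (intro bound inv(1)) auto
      then show ?thesis
        using True \<kappa> by (simp add: ennreal_mult'[symmetric] ennreal_leI)
    qed simp
  qed
  also have "\<dots> = ennreal \<kappa> * (\<integral>\<^sup>+ y. ennreal \<bar>det (matrix ((*v) (J (chart_inv B y))))\<bar> * indicator T y \<partial>lborel)"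
  proof (rule nn_integral_cmult)
    have "(\<lambda>y. indicator T y *\<^sub>R \<bar>det (J (chart_inv B y))\<bar>) \<in> borel_measurable borel"
      by (intro borel_measurable_continuous_on_indicator T continuous_on_rabs continuous_on_det contJ)
    then have "(\<lambda>y. ennreal (indicator T y *\<^sub>R \<bar>det (J (chart_inv B y))\<bar>)) \<in> borel_measurable lborel"
      by simp
    then show "(\<lambda>y. ennreal \<bar>det (matrix ((*v) (J (chart_inv B y))))\<bar> * indicator T y) \<in> borel_measurable lborel"
      by (rule back_subst[where P = "\<lambda>f. f \<in> borel_measurable lborel"]) (auto simp: indicator_def)
  qed
  also have "\<dots> \<le> ennreal \<kappa> * emeasure lborel (F ` T)"
  proof (intro mult_left_mono nn_integral_jacobian_le T FT)
    show "(F has_derivative (*v) (J (chart_inv B z))) (at z within T)" if "z \<in> T" for z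
      using that TU by (auto intro: has_derivative_at_withinI[OF derF])
    show "inj_on F T"
      using injF TU by (rule inj_on_subset)
    show "continuous_on T (\<lambda>z. det (matrix ((*v) (J (chart_inv B z)))))"
      using continuous_on_det[OF contJ] by simp
  qed simp
  finally show "emeasure \<nu> D \<le> ennreal \<kappa> * emeasure lborel (G ` D)"
    by (simp add: FTD)
qed

text \<open>The main tool for volumes: an injective map whose Jacobian dominates \<open>sqrt (det g) / \<kappa>\<close> in all
charts pulls back sets with at most \<open>\<kappa>\<close> times their measure. The preimage is cut into countably
many Borel pieces, each inside one chart; by injectivity their images are disjoint subsets of
\<open>E\<close>, so the estimates add up.\<close>

lemma riemannian_volume_preimage_le:
  fixes N :: "('a::{t2_space,second_countable_topology}, 'n::finite) riem"
    and G :: "'a \<Rightarrow> real ^ 'n"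
  assumes N: "riemannian_manifold N" and \<nu>: "riemannian_volume N \<nu>"
    and W: "open W" and inj: "inj_on G W" and E: "E \<in> sets borel"
    and der: "\<And>B y. B \<in> atlas N \<Longrightarrow> y \<in> W \<inter> fst B \<Longrightarrow>
                ((G \<circ> chart_inv B) has_derivative (*v) (J B y)) (at (snd B y))"
    and cont: "\<And>B. B \<in> atlas N \<Longrightarrow> continuous_on (W \<inter> fst B) (J B)"
    and bound: "\<And>B y. B \<in> atlas N \<Longrightarrow> y \<in> W \<inter> fst B \<Longrightarrow>
                sqrt (det (gmat N B y)) \<le> \<kappa> * \<bar>det (J B y)\<bar>"
    and \<kappa>: "0 \<le> \<kappa>"
  shows "outer_measure_of \<nu> {y\<in>W. G y \<in> E} \<le> ennreal \<kappa> * emeasure lborel E"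
proof -
  have sets: "sets \<nu> = sets borel"
    using \<nu> by (simp add: riemannian_volume_def)
  obtain A :: "nat \<Rightarrow> ('a, 'n) chart" where A: "\<And>i. A i \<in> atlas N" "(\<Union>i. fst (A i)) = UNIV"
    using countable_atlas[OF N] by metis
  have ch: "is_chart (A i)" for i
    using N A(1) by (simp add: riemannian_manifold_def)
  have contG: "continuous_on W G"
  proof -
    have "continuous_on (W \<inter> fst (A i)) G" for i
    proof -
      note hom = homeomorphism_chart[OF ch[of i]]
      have "continuous_on (snd (A i) ` (W \<inter> fst (A i))) (G \<circ> chart_inv (A i))"
      proof (intro continuous_at_imp_continuous_on ballI)
        fix z assume "z \<in> snd (A i) ` (W \<inter> fst (A i))"
        then show "isCont (G \<circ> chart_inv (A i)) z"
          using has_derivative_continuous[OF der[OF A(1)]] by auto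
      qed
      then have "continuous_on (W \<inter> fst (A i)) ((G \<circ> chart_inv (A i)) \<circ> snd (A i))"
        by (intro continuous_on_compose[OF continuous_on_subset[OF homeomorphism_cont1[OF hom(1)]]]) auto
      then show ?thesis
        by (rule continuous_on_cong[THEN iffD1, rotated -1]) (auto simp: hom(4))
    qed
    then have "continuous_on (\<Union>i. W \<inter> fst (A i)) G"
      using W by (intro continuous_on_open_UN) (auto intro!: open_Int homeomorphism_chart(2) ch)
    moreover have "(\<Union>i. W \<inter> fst (A i)) = W"
      using A(2) by auto
    ultimately show ?thesis by simp
  qed
  define Z where "Z = {y\<in>W. G y \<in> E}"
  have Z: "Z \<in> sets borel"
  proof -
    have "G -` E \<inter> W \<in> sets (restrict_space borel W)"
      using measurable_sets[OF borel_measurable_continuous_on_restrict[OF contG] E]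
      by (simp add: space_restrict_space)
    moreover have "G -` E \<inter> W = Z" by (auto simp: Z_def)
    ultimately show ?thesis
      using W by (simp add: sets_restrict_space_iff)
  qed
  define D where "D i = Z \<inter> disjointed (\<lambda>i. fst (A i)) i" for i
  have "range (\<lambda>i. fst (A i)) \<subseteq> sets borel"
    using homeomorphism_chart(2)[OF ch] by auto
  then have dis: "range (disjointed (\<lambda>i. fst (A i))) \<subseteq> sets borel"
    by (rule sets.range_disjointed_sets)
  have D: "D i \<in> sets borel" "D i \<subseteq> W \<inter> fst (A i)" "D i \<subseteq> Z" for i
    using Z dis disjointed_subset[of "\<lambda>i. fst (A i)" i] by (auto simp: D_def Z_def)
  have disD: "disjoint_family D"
    using disjoint_family_disjointed[of "\<lambda>i. fst (A i)"] by (auto simp: D_def disjoint_family_on_def)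
  have UD: "(\<Union>i. D i) = Z"
    using A(2) UN_disjointed_eq[of "\<lambda>i. fst (A i)"] by (auto simp: D_def)
  note piece = riemannian_volume_chart_piece_le[OF N \<nu> A(1) W inj D(1,2) der[OF A(1)] cont[OF A(1)] bound[OF A(1)] \<kappa>]
  have disG: "disjoint_family (\<lambda>i. G ` D i)"
    unfolding disjoint_family_on_def
  proof (intro ballI impI)
    fix i j :: nat assume "i \<noteq> j"
    then have "D i \<inter> D j = {}"
      using disD by (simp add: disjoint_family_on_def)
    then show "G ` D i \<inter> G ` D j = {}"
      using inj_on_image_Int[OF inj, of "D i" "D j"] D(2) by blast
  qed
  have "outer_measure_of \<nu> Z = emeasure \<nu> Z"
    using Z sets by simp
  also have "\<dots> = (\<Sum>i. emeasure \<nu> (D i))"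
    using suminf_emeasure[OF _ disD, of \<nu>] D(1) by (simp add: sets UD image_subset_iff)
  also have "\<dots> \<le> (\<Sum>i. ennreal \<kappa> * emeasure lborel (G ` D i))"
    by (intro suminf_le piece summableI)
  also have "\<dots> = ennreal \<kappa> * (\<Sum>i. emeasure lborel (G ` D i))"
    by simp
  also have "(\<Sum>i. emeasure lborel (G ` D i)) = emeasure lborel (\<Union>i. G ` D i)"
    using piece(1) by (intro suminf_emeasure disG) auto
  also have "ennreal \<kappa> * \<dots> \<le> ennreal \<kappa> * emeasure lborel E"
    using D(3) E by (intro mult_left_mono emeasure_mono) (auto simp: Z_def)
  finally show ?thesis by (simp add: Z_def)
qed

section \<open>The covector maps and their derivatives\<close>

lemma chart_at:
  assumes "riemannian_manifold M"
  shows "chart_at M x \<in> atlas M" and "x \<in> fst (chart_at M x)"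
proof -
  have "x \<in> (\<Union>A\<in>atlas M. fst A)"
    using assms by (simp add: riemannian_manifold_def)
  then have "\<exists>A. A \<in> atlas M \<and> x \<in> fst A"
    by blast
  from someI_ex[OF this] show "chart_at M x \<in> atlas M" and "x \<in> fst (chart_at M x)"
    by (simp_all add: chart_at_def)
qed

lemma is_chart_atlas: "riemannian_manifold M \<Longrightarrow> A \<in> atlas M \<Longrightarrow> is_chart A"
  by (simp add: riemannian_manifold_def)

lemma sqrt_det_gmat_pos:
  assumes "riemannian_manifold M" "A \<in> atlas M" "x \<in> fst A"
  shows "sqrt (det (gmat M A x)) > 0"
  using assms by (simp add: riemannian_manifold_def det_pos_if_positive_definite)

lemma chart_differentiable_has_derivative:
  fixes A :: "('a, 'n::finite) chart"
  assumes "chart_differentiable A f x"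
  shows "((f \<circ> chart_inv A) has_derivative (\<lambda>v. \<Sum>i\<in>UNIV. v $ i * chart_pd A i f x)) (at (snd A x))"
proof -
  define D where "D = frechet_derivative (f \<circ> chart_inv A) (at (snd A x))"
  have D: "((f \<circ> chart_inv A) has_derivative D) (at (snd A x))"
    using assms by (simp add: chart_differentiable_def D_def frechet_derivative_works)
  then have lin: "linear D"
    by (rule has_derivative_linear)
  have "D v = (\<Sum>i\<in>UNIV. v $ i * chart_pd A i f x)" for v
  proof -
    have "D v = D (\<Sum>i\<in>UNIV. v $ i *\<^sub>R axis i 1)"
      using basis_expansion[of v] by (simp add: scalar_mult_eq_scaleR)
    also have "\<dots> = (\<Sum>i\<in>UNIV. v $ i * D (axis i 1))"
      by (simp add: linear_sum[OF lin] linear_scale[OF lin])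
    finally show ?thesis
      by (simp add: chart_pd_def D_def)
  qed
  then have "D = (\<lambda>v. \<Sum>i\<in>UNIV. v $ i * chart_pd A i f x)" ..
  with D show ?thesis by simp
qed

lemma chart_pd_along_coordinate_line:
  fixes A :: "('a::topological_space, 'n::finite) chart"
  assumes A: "is_chart A" and z: "z + s *\<^sub>R axis i 1 \<in> snd A ` fst A"
    and diff: "chart_differentiable A f (chart_inv A (z + s *\<^sub>R axis i 1))"
  shows "((\<lambda>s. f (chart_inv A (z + s *\<^sub>R axis i 1))) has_real_derivative
            chart_pd A i f (chart_inv A (z + s *\<^sub>R axis i 1))) (at s)"
proof -
  define x where "x = chart_inv A (z + s *\<^sub>R axis i 1)"
  have x: "snd A x = z + s *\<^sub>R axis i 1"
    using z homeomorphism_chart(4)[OF A] by (auto simp: x_def)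
  have 1: "((\<lambda>s. z + s *\<^sub>R axis i 1 :: real ^ 'n) has_derivative (\<lambda>t. t *\<^sub>R axis i 1)) (at s)"
    by (auto intro!: derivative_eq_intros)
  have 2: "((f \<circ> chart_inv A) has_derivative (\<lambda>v. \<Sum>j\<in>UNIV. v $ j * chart_pd A j f x)) (at (z + s *\<^sub>R axis i 1))"
    using chart_differentiable_has_derivative[of A f x] diff x by (simp add: x_def)
  have "(\<lambda>t::real. \<Sum>j\<in>UNIV. (t *\<^sub>R axis i 1) $ j * chart_pd A j f x) = (*) (chart_pd A i f x)"
  proof
    fix t :: real
    have "(\<Sum>j\<in>UNIV. (t *\<^sub>R axis i 1) $ j * chart_pd A j f x)
        = (\<Sum>j\<in>UNIV. if j = i then t * chart_pd A i f x else 0)"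
      by (intro sum.cong) (auto simp: axis_def)
    then show "(\<Sum>j\<in>UNIV. (t *\<^sub>R axis i 1) $ j * chart_pd A j f x) = chart_pd A i f x * t"
      by simp
  qed
  then show ?thesis
    using diff_chain_at[OF 1 2] unfolding has_field_derivative_def x_def[symmetric]
    by (simp add: o_def)
qed

lemma cost_pd_Nil: "cost_pd A B c [] = c"
  by (intro ext) simp

lemma cost_pd_cl_inside:
  "x \<in> \<Omega> \<Longrightarrow> y \<in> \<Omega>' \<Longrightarrow> cost_pd_cl \<Omega> \<Omega>' A B c w x y = cost_pd A B c w x y"
  by (simp add: cost_pd_cl_def ext_closure_def)

lemma C3_cost_inside:
  assumes C3: "C3_cost M M' \<Omega> \<Omega>' c" and "A \<in> atlas M" "B \<in> atlas M'" "C3_word w"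
  shows "x \<in> \<Omega> \<inter> fst A \<Longrightarrow> y \<in> \<Omega>' \<inter> fst B \<Longrightarrow> cost_pd_exists A B c w x y"
    and "continuous_on ((\<Omega> \<inter> fst A) \<times> (\<Omega>' \<inter> fst B)) (\<lambda>(x, y). cost_pd A B c w x y)"
proof -
  show "x \<in> \<Omega> \<inter> fst A \<Longrightarrow> y \<in> \<Omega>' \<inter> fst B \<Longrightarrow> cost_pd_exists A B c w x y"
    using assms unfolding C3_cost_def by simp
  have "continuous_on ((closure \<Omega> \<inter> fst A) \<times> (closure \<Omega>' \<inter> fst B)) (\<lambda>(x, y). cost_pd_cl \<Omega> \<Omega>' A B c w x y)"
    using assms unfolding C3_cost_def by simp
  then have "continuous_on ((\<Omega> \<inter> fst A) \<times> (\<Omega>' \<inter> fst B)) (\<lambda>(x, y). cost_pd_cl \<Omega> \<Omega>' A B c w x y)"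
    by (rule continuous_on_subset) (use closure_subset[of \<Omega>] closure_subset[of \<Omega>'] in auto)
  then show "continuous_on ((\<Omega> \<inter> fst A) \<times> (\<Omega>' \<inter> fst B)) (\<lambda>(x, y). cost_pd A B c w x y)"
    by (rule continuous_on_cong[THEN iffD1, rotated -1]) (auto simp: cost_pd_cl_inside)
qed

lemma C3_words: "C3_word []" "C3_word [a]" "C3_word [Inl i, Inr j]" "C3_word [Inr j, Inl i]"
  by (auto simp: C3_word_def)

text \<open>The bounds on the cost control only one of the two mixed matrices; the symmetry of mixed partial
derivatives transfers them to the other one, which is the derivative of the covector map based at
a point of the second domain.\<close>

lemma mixed_cost_pd_commute:
  fixes M :: "('a::{t2_space,second_countable_topology}, 'n::finite) riem"
    and M' :: "('b::{t2_space,second_countable_topology}, 'n) riem"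
  assumes M: "riemannian_manifold M" "riemannian_manifold M'"
    and C3: "C3_cost M M' \<Omega> \<Omega>' c" and op: "open \<Omega>" "open \<Omega>'"
    and A: "A \<in> atlas M" and B: "B \<in> atlas M'"
    and x: "x \<in> \<Omega> \<inter> fst A" and y: "y \<in> \<Omega>' \<inter> fst B"
  shows "cost_pd A B c [Inl i, Inr j] x y = cost_pd A B c [Inr j, Inl i] x y"
proof -
  note chA = is_chart_atlas[OF M(1) A] and chB = is_chart_atlas[OF M(2) B]
  define X where "X s = chart_inv A (snd A x + s *\<^sub>R axis i 1)" for s :: real
  define Y where "Y t = chart_inv B (snd B y + t *\<^sub>R axis j 1)" for t :: real
  define U where "U = (\<lambda>s::real. snd A x + s *\<^sub>R axis i 1) -` (snd A ` (\<Omega> \<inter> fst A))"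
  define V where "V = (\<lambda>t::real. snd B y + t *\<^sub>R axis j 1) -` (snd B ` (\<Omega>' \<inter> fst B))"
  have "open U" "open V"
    unfolding U_def V_def
    by (intro open_vimage open_chart_image chA chB op continuous_intros)+
  moreover have "0 \<in> U" "0 \<in> V"
    using x y by (auto simp: U_def V_def)
  ultimately obtain d1 d2 where d12: "d1 > 0" "ball 0 d1 \<subseteq> U" "d2 > 0" "ball 0 d2 \<subseteq> V"
    by (meson openE)
  define d where "d = min d1 d2"
  have d: "d > 0" and UV: "\<bar>s\<bar> < d \<Longrightarrow> s \<in> U" "\<bar>s\<bar> < d \<Longrightarrow> s \<in> V" for s
    using d12 by (auto simp: d_def subset_iff dist_real_def)
  have X: "X s \<in> \<Omega> \<inter> fst A" "snd A x + s *\<^sub>R axis i 1 \<in> snd A ` fst A" if "\<bar>s\<bar> < d" for s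
    using UV(1)[OF that] homeomorphism_chart(4)[OF chA] by (auto simp: U_def X_def)
  have Y: "Y t \<in> \<Omega>' \<inter> fst B" "snd B y + t *\<^sub>R axis j 1 \<in> snd B ` fst B" if "\<bar>t\<bar> < d" for t
    using UV(2)[OF that] homeomorphism_chart(4)[OF chB] by (auto simp: V_def Y_def)
  have X0: "X 0 = x" and Y0: "Y 0 = y"
    using x y homeomorphism_chart(4)[OF chA] homeomorphism_chart(4)[OF chB] by (auto simp: X_def Y_def)
  have contX: "continuous_on {-d<..<d} X"
    unfolding X_def
    by (intro continuous_on_compose2[OF homeomorphism_cont2[OF homeomorphism_chart(1)[OF chA]]] continuous_intros)
      (use X(2) in auto)
  have contY: "continuous_on {-d<..<d} Y"
    unfolding Y_def
    by (intro continuous_on_compose2[OF homeomorphism_cont2[OF homeomorphism_chart(1)[OF chB]]] continuous_intros)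
      (use Y(2) in auto)
  have cont: "isCont (\<lambda>(s, t). cost_pd A B c w (X s) (Y t)) (0, 0)" if w: "C3_word w" for w
  proof -
    have pair: "continuous_on ({-d<..<d} \<times> {-d<..<d}) (\<lambda>z. (X (fst z), Y (snd z)))"
      by (intro continuous_on_Pair continuous_on_compose2[OF contX] continuous_on_compose2[OF contY]
          continuous_intros) auto
    have "continuous_on ({-d<..<d} \<times> {-d<..<d}) 
        (\<lambda>z. (\<lambda>(x, y). cost_pd A B c w x y) (X (fst z), Y (snd z)))"
      by (rule continuous_on_compose2[OF C3_cost_inside(2)[OF C3 A B w] pair]) (use X Y in auto)
    then have "continuous_on ({-d<..<d} \<times> {-d<..<d}) (\<lambda>(s, t). cost_pd A B c w (X s) (Y t))"
      by (simp add: case_prod_unfold)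
    then show ?thesis
      by (rule continuous_on_interior) (use d in \<open>simp add: interior_open open_Times\<close>)
  qed
  have ex: "cost_pd_exists A B c w (X s) (Y t)" if "C3_word w" "\<bar>s\<bar> < d" "\<bar>t\<bar> < d" for w s t
    using C3_cost_inside(1)[OF C3 A B that(1)] X(1)[OF that(2)] Y(1)[OF that(3)] by blast
  have dX: "((\<lambda>s. cost_pd A B c w (X s) (Y t)) has_real_derivative cost_pd A B c (Inl i # w) (X s) (Y t)) (at s)"
    if "C3_word (Inl i # w)" "\<bar>s\<bar> < d" "\<bar>t\<bar> < d" for w s t
    using chart_pd_along_coordinate_line[OF chA X(2)[OF that(2)]] ex[OF that] by (simp add: X_def)
  have dY: "((\<lambda>t. cost_pd A B c w (X s) (Y t)) has_real_derivative cost_pd A B c (Inr j # w) (X s) (Y t)) (at t)"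
    if "C3_word (Inr j # w)" "\<bar>s\<bar> < d" "\<bar>t\<bar> < d" for w s t
    using chart_pd_along_coordinate_line[OF chB Y(2)[OF that(3)]] ex[OF that] by (simp add: Y_def)
  have "cost_pd A B c [Inr j, Inl i] (X 0) (Y 0) = cost_pd A B c [Inl i, Inr j] (X 0) (Y 0)"
    by (rule mixed_partials_commute[where f = "\<lambda>s t. cost_pd A B c [] (X s) (Y t)"
          and ?f1.0 = "\<lambda>s t. cost_pd A B c [Inl i] (X s) (Y t)"
          and ?f2.0 = "\<lambda>s t. cost_pd A B c [Inr j] (X s) (Y t)"
          and ?f12.0 = "\<lambda>s t. cost_pd A B c [Inr j, Inl i] (X s) (Y t)"
          and ?f21.0 = "\<lambda>s t. cost_pd A B c [Inl i, Inr j] (X s) (Y t)"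
          and d = d])
      (rule d | assumption | rule dX dY cont C3_words)+
  then show ?thesis
    by (simp only: X0 Y0)
qed

lemma mixed_matrix_adj_eq_transpose:
  fixes M :: "('a::{t2_space,second_countable_topology}, 'n::finite) riem"
    and M' :: "('b::{t2_space,second_countable_topology}, 'n) riem"
  assumes "riemannian_manifold M" "riemannian_manifold M'"
    and "C3_cost M M' \<Omega> \<Omega>' c" and "open \<Omega>" "open \<Omega>'"
    and "A \<in> atlas M" and "B \<in> atlas M'"
    and "x \<in> \<Omega> \<inter> fst A" and "y \<in> \<Omega>' \<inter> fst B"
  shows "mixed_matrix_adj \<Omega> \<Omega>' A B c x y = transpose (mixed_matrix \<Omega> \<Omega>' A B c x y)"
  using assms(8,9) mixed_cost_pd_commute[OF assms]
  by (simp add: mixed_matrix_adj_def mixed_matrix_def transpose_def cost_pd_cl_inside del: cost_pd.simps)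

lemma has_derivative_vec_lambda:
  assumes "\<And>i. ((f i :: _ \<Rightarrow> real) has_derivative f' i) (at z)"
  shows "((\<lambda>z. \<chi> i::'n::finite. f i z) has_derivative (\<lambda>v. \<chi> i. f' i v)) (at z)"
  by (rule has_derivative_componentwise_within[THEN iffD2]) (use assms in \<open>auto simp: Basis_vec_def inner_axis\<close>)

text \<open>The components of \<open>-Dc(x,\<sqdot>)\<close> are first partial derivatives of the cost, and the differentiability of
these in the second variable is part of the \<open>C\<^sup>3\<close> assumption.\<close>

lemma covec_has_derivative:
  fixes M :: "('a::{t2_space,second_countable_topology}, 'n::finite) riem"
    and M' :: "('b::{t2_space,second_countable_topology}, 'n) riem"
  assumes M: "riemannian_manifold M"
    and C3: "C3_cost M M' \<Omega> \<Omega>' c" and B: "B \<in> atlas M'"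
    and x: "x \<in> \<Omega>" and y: "y \<in> \<Omega>' \<inter> fst B"
  shows "((covec M c x \<circ> chart_inv B) has_derivative
            (*v) (mixed_matrix \<Omega> \<Omega>' (chart_at M x) B c x y)) (at (snd B y))"
proof -
  define A where "A = chart_at M x"
  have A: "A \<in> atlas M" "x \<in> fst A"
    using chart_at[OF M] by (simp_all add: A_def)
  have comp: "((\<lambda>z. - cost_pd A B c [Inl i] x (chart_inv B z)) has_derivative
      (\<lambda>v. \<Sum>j\<in>UNIV. mixed_matrix \<Omega> \<Omega>' A B c x y $ i $ j * v $ j)) (at (snd B y))" for i
  proof -
    have "cost_pd_exists A B c [Inr undefined, Inl i] x y"
      using C3_cost_inside(1)[OF C3 A(1) B C3_words(4)] x y A(2) by blast
    then have "chart_differentiable B (cost_pd A B c [Inl i] x) y"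
      by (simp del: cost_pd.simps)
    from has_derivative_minus[OF chart_differentiable_has_derivative[OF this]] show ?thesis
      using x y by (simp add: mixed_matrix_def cost_pd_cl_inside o_def sum_negf[symmetric] mult.commute)
  qed
  have "((\<lambda>z. \<chi> i. - cost_pd A B c [Inl i] x (chart_inv B z)) has_derivative
      (\<lambda>v. \<chi> i. \<Sum>j\<in>UNIV. mixed_matrix \<Omega> \<Omega>' A B c x y $ i $ j * v $ j)) (at (snd B y))"
    by (intro has_derivative_vec_lambda comp)
  then show ?thesis
    by (simp add: covec_def[abs_def] o_def A_def matrix_vector_mult_def[abs_def] cost_pd_Nil)
qed

lemma covec_flip_has_derivative:
  fixes M :: "('a::{t2_space,second_countable_topology}, 'n::finite) riem"
    and M' :: "('b::{t2_space,second_countable_topology}, 'n) riem"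
  assumes M: "riemannian_manifold M" "riemannian_manifold M'"
    and C3: "C3_cost M M' \<Omega> \<Omega>' c" and op: "open \<Omega>" "open \<Omega>'"
    and A: "A \<in> atlas M" and x: "x \<in> \<Omega> \<inter> fst A" and y: "y \<in> \<Omega>'"
  shows "((covec M' (flip c) y \<circ> chart_inv A) has_derivative
            (*v) (transpose (mixed_matrix \<Omega> \<Omega>' A (chart_at M' y) c x y))) (at (snd A x))"
proof -
  define B where "B = chart_at M' y"
  have B: "B \<in> atlas M'" "y \<in> fst B"
    using chart_at[OF M(2)] by (simp_all add: B_def)
  have adj: "mixed_matrix_adj \<Omega> \<Omega>' A B c x y = transpose (mixed_matrix \<Omega> \<Omega>' A B c x y)"
    using mixed_matrix_adj_eq_transpose[OF M C3 op A B(1) x] y B(2) by blast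
  have comp: "((\<lambda>z. - cost_pd A B c [Inr j] (chart_inv A z) y) has_derivative
      (\<lambda>v. \<Sum>i\<in>UNIV. mixed_matrix_adj \<Omega> \<Omega>' A B c x y $ j $ i * v $ i)) (at (snd A x))" for j
  proof -
    have "cost_pd_exists A B c [Inl undefined, Inr j] x y"
      using C3_cost_inside(1)[OF C3 A B(1) C3_words(3)] x y B(2) by blast
    then have "chart_differentiable A (\<lambda>x. cost_pd A B c [Inr j] x y) x"
      by (simp del: cost_pd.simps)
    from has_derivative_minus[OF chart_differentiable_has_derivative[OF this]] show ?thesis
      using x y by (simp add: mixed_matrix_adj_def cost_pd_cl_inside o_def sum_negf[symmetric] mult.commute)
  qed
  have "((\<lambda>z. \<chi> j. - cost_pd A B c [Inr j] (chart_inv A z) y) has_derivative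
      (\<lambda>v. \<chi> j. \<Sum>i\<in>UNIV. mixed_matrix_adj \<Omega> \<Omega>' A B c x y $ j $ i * v $ i)) (at (snd A x))"
    by (intro has_derivative_vec_lambda comp)
  then show ?thesis
    by (simp add: adj[unfolded B_def] covec_def[abs_def] flip_def o_def B_def matrix_vector_mult_def[abs_def] cost_pd_Nil)
qed

lemma continuous_on_mixed_matrix:
  assumes C3: "C3_cost M M' \<Omega> \<Omega>' c" and A: "A \<in> atlas M" and B: "B \<in> atlas M'"
  shows "continuous_on ((\<Omega> \<inter> fst A) \<times> (\<Omega>' \<inter> fst B)) (\<lambda>(x, y). mixed_matrix \<Omega> \<Omega>' A B c x y)"
proof -
  have "continuous_on ((\<Omega> \<inter> fst A) \<times> (\<Omega>' \<inter> fst B))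
      (\<lambda>z. \<chi> i j. - (\<lambda>(x, y). cost_pd A B c [Inr j, Inl i] x y) z)"
    by (intro continuous_on_vec_lambda continuous_on_minus C3_cost_inside(2)[OF C3 A B C3_words(4)])
  then show ?thesis
    by (rule continuous_on_cong[THEN iffD1, rotated -1])
      (auto simp: mixed_matrix_def cost_pd_cl_inside vec_eq_iff simp del: cost_pd.simps)
qed

text \<open>The bounds on the determinant of the inverse mixed matrix in orthonormal frames, with the metric
densities written out and the quotients cleared.\<close>

lemma mixed_matrix_bounds:
  fixes M :: "('a::{t2_space,second_countable_topology}, 'n::finite) riem"
    and M' :: "('b::{t2_space,second_countable_topology}, 'n) riem"
  assumes M: "riemannian_manifold M" "riemannian_manifold M'"
    and nd: "Nondeg M M' \<Omega> \<Omega>' c" and mb: "mixed_bounds M M' \<Omega> \<Omega>' c K"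
    and A: "A \<in> atlas M" and B: "B \<in> atlas M'"
    and x: "x \<in> \<Omega> \<inter> fst A" and y: "y \<in> \<Omega>' \<inter> fst B"
  shows "invertible (mixed_matrix \<Omega> \<Omega>' A B c x y)"
    and "sqrt (det (gmat M A x)) * sqrt (det (gmat M' B y)) \<le> K * \<bar>det (mixed_matrix \<Omega> \<Omega>' A B c x y)\<bar>"
    and "\<bar>det (mixed_matrix \<Omega> \<Omega>' A B c x y)\<bar> \<le> K * (sqrt (det (gmat M A x)) * sqrt (det (gmat M' B y)))"
    and "0 \<le> K"
proof -
  define J where "J = mixed_matrix \<Omega> \<Omega>' A B c x y"
  have cl: "x \<in> closure \<Omega> \<inter> fst A" "y \<in> closure \<Omega>' \<inter> fst B"
    using x y closure_subset[of \<Omega>] closure_subset[of \<Omega>'] by auto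
  show inv: "invertible (mixed_matrix \<Omega> \<Omega>' A B c x y)"
    using nd A B cl by (simp add: Nondeg_def)
  define g where "g = sqrt (det (gmat M A x)) * sqrt (det (gmat M' B y))"
  have g: "g > 0"
    unfolding g_def using x y by (intro mult_pos_pos sqrt_det_gmat_pos M A B) auto
  have "det J * det (matrix_inv J) = 1"
    using matrix_inv_mult(1)[OF inv] by (metis J_def det_I det_mul)
  then have "\<bar>det J\<bar> * \<bar>det (matrix_inv J)\<bar> = 1" and J0: "det J \<noteq> 0"
    by (auto simp flip: abs_mult)
  then have J: "det J \<noteq> 0" "\<bar>det (matrix_inv J)\<bar> = 1 / \<bar>det J\<bar>"
    by (auto simp: field_simps)
  have "inv_mixed_det M M' \<Omega> \<Omega>' A B c x y \<le> K \<and> inverse (inv_mixed_det M M' \<Omega> \<Omega>' A B c x y) \<le> K"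
    using mb A B cl by (simp add: mixed_bounds_def)
  moreover have "inv_mixed_det M M' \<Omega> \<Omega>' A B c x y = g / \<bar>det J\<bar>"
    using J(2) by (simp add: inv_mixed_det_def J_def g_def mult.assoc)
  ultimately have K: "g / \<bar>det J\<bar> \<le> K" "\<bar>det J\<bar> / g \<le> K"
    by simp_all
  show "sqrt (det (gmat M A x)) * sqrt (det (gmat M' B y)) \<le> K * \<bar>det (mixed_matrix \<Omega> \<Omega>' A B c x y)\<bar>"
    using K(1) J(1) by (simp add: g_def[symmetric] J_def[symmetric] divide_simps)
  show "\<bar>det (mixed_matrix \<Omega> \<Omega>' A B c x y)\<bar> \<le> K * (sqrt (det (gmat M A x)) * sqrt (det (gmat M' B y)))"
    using K(2) g by (simp add: g_def[symmetric] J_def[symmetric] divide_simps)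
  have "0 \<le> \<bar>det J\<bar> / g" using g by simp
  with K(2) show "0 \<le> K" by linarith
qed

lemma c_exp_covec:
  assumes "inj_on (covec M c x) \<Omega>'" "y \<in> \<Omega>'"
  shows "c_exp M c \<Omega>' x (covec M c x y) = y"
  unfolding c_exp_def by (rule the_equality) (use assms in \<open>auto dest: inj_onD\<close>)

lemma c_segment_eq:
  assumes "inj_on (covec M c x) \<Omega>'" "y \<in> \<Omega>'"
    and "covec M c x y = (1 - t) *\<^sub>R covec M c x y0 + t *\<^sub>R covec M c x y1"
  shows "c_segment M c \<Omega>' x y0 y1 t = y"
  using c_exp_covec[OF assms(1,2)] assms(3) by (simp add: c_segment_def)

section \<open>Consequences of quantitative quasi-convexity\<close>

text \<open>Quantitative quasi-convexity along the \<open>c\<close>-segment from \<open>x0\<close> to \<open>x1\<close> says that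
\<open>f = -c(\<sqdot>,y1) + c(\<sqdot>,y0)\<close> grows at most by \<open>M0 s k\<close> up to the time \<open>s\<close>. Dividing by \<open>s\<close> and
letting \<open>s \<rightarrow> 0\<close> bounds the derivative of \<open>f\<close> in the initial direction of the segment. In the
covector coordinate \<open>q = -D'c(\<sqdot>,y0)\<close> the segment is straight, so this direction is obtained by
applying the inverse of the derivative of \<open>q\<close>, the matrix \<open>transpose J\<close>, to \<open>q x1 - q x0\<close>;
the differential of \<open>f\<close> at \<open>x0\<close> is the difference of the covectors of \<open>y1\<close> and \<open>y0\<close>.\<close>

lemma QQConv_gradient_le:
  fixes M :: "('a::{t2_space,second_countable_topology}, 'n::finite) riem"
    and M' :: "('b::{t2_space,second_countable_topology}, 'n) riem"
  assumes M: "riemannian_manifold M" "riemannian_manifold M'"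
    and op: "open \<Omega>" "open \<Omega>'" and C3: "C3_cost M M' \<Omega> \<Omega>' c"
    and tw: "Twist M M' \<Omega> \<Omega>' c" and qq: "QQConv M M' \<Omega> \<Omega>' c M0" and M0: "1 \<le> M0"
    and x: "x0 \<in> \<Omega>" "x1 \<in> \<Omega>" and y: "y0 \<in> \<Omega>'" "y1 \<in> \<Omega>'"
    and J: "J = mixed_matrix \<Omega> \<Omega>' (chart_at M x0) (chart_at M' y0) c x0 y0" "invertible J"
    and k: "- c x1 y1 + c x0 y1 - (- c x1 y0 + c x0 y0) \<le> k" "0 \<le> k"
  shows "(matrix_inv (transpose J) *v (covec M' (flip c) y0 x1 - covec M' (flip c) y0 x0))
           \<bullet> (covec M c x0 y1 - covec M c x0 y0) \<le> M0 * k"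
proof -
  define A where "A = chart_at M x0"
  define q where "q = covec M' (flip c) y0"
  define w where "w = covec M c x0 y1 - covec M c x0 y0"
  define b where "b = q x1 - q x0"
  define P where "P = transpose J"
  define P' where "P' = matrix_inv P"
  define U where "U = snd A ` (\<Omega> \<inter> fst A)"
  define F where "F = q \<circ> chart_inv A"
  define z0 where "z0 = snd A x0"
  define f where "f = (\<lambda>x. - c x y1 + c x y0)"
  have A: "A \<in> atlas M" "x0 \<in> fst A"
    using chart_at[OF M(1)] by (simp_all add: A_def)
  note ch = is_chart_atlas[OF M(1) A(1)]
  have injq: "inj_on q \<Omega>"
    using tw y by (simp add: Twist_def q_def)
  have U: "open U"
    unfolding U_def by (rule open_chart_image[OF ch op(1)])
  have z0: "z0 \<in> U" "chart_inv A z0 = x0"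
    using x A homeomorphism_chart(4)[OF ch] by (auto simp: U_def z0_def)
  have inv: "chart_inv A z \<in> \<Omega> \<inter> fst A" "snd A (chart_inv A z) = z" if "z \<in> U" for z
    using that homeomorphism_chart(4)[OF ch] by (auto simp: U_def)
  have derF: "(F has_derivative (*v) (transpose (mixed_matrix \<Omega> \<Omega>' A (chart_at M' y0) c (chart_inv A z) y0))) (at z)"
    if "z \<in> U" for z
    using covec_flip_has_derivative[OF M C3 op A(1) inv(1)[OF that] y(1)] inv(2)[OF that]
    by (simp add: F_def q_def)
  have contF: "continuous_on U F"
    by (intro continuous_at_imp_continuous_on ballI has_derivative_continuous[OF derF])
  have injF: "inj_on F U"
  proof (rule inj_onI)
    fix z z' assume z: "z \<in> U" "z' \<in> U" and "F z = F z'"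
    then have "chart_inv A z = chart_inv A z'"
      using inj_onD[OF injq] inv(1)[OF z(1)] inv(1)[OF z(2)] by (simp add: F_def)
    then show "z = z'"
      by (metis inv(2)[OF z(1)] inv(2)[OF z(2)])
  qed
  \<comment> \<open>\<open>h\<close> is the \<open>c\<close>-exponential map with base point \<open>y0\<close>, read in the chart \<open>A\<close>.\<close>
  obtain h where h: "homeomorphism U (F ` U) F h"
    using invariance_of_domain_homeomorphism[OF U contF order_refl injF] .
  have FU: "open (F ` U)"
    using contF U injF by (rule invariance_of_domain)
  have hF: "h (F z) = z" if "z \<in> U" for z
    using h that by (rule homeomorphism_apply1)
  have PP': "P ** P' = mat 1"
    using matrix_inv_mult(1)[of P] J(2) by (simp add: P_def P'_def invertible_det_nz)
  have Fz0: "F z0 = q x0"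
    by (simp add: F_def z0)
  have derh: "(h has_derivative (*v) P') (at (q x0))"
  proof -
    have "(F has_derivative (*v) P) (at z0)"
      using derF[OF z0(1)] by (simp add: z0(2) P_def J(1) A_def[symmetric])
    moreover have "(*v) P \<circ> (*v) P' = id"
      by (auto simp: matrix_vector_mul_assoc PP')
    ultimately show ?thesis
      using has_derivative_inverse_strong[OF U z0(1) contF hF] Fz0 by simp
  qed
  have derf: "((f \<circ> chart_inv A) has_derivative (\<lambda>v. v \<bullet> w)) (at z0)"
  proof -
    have d: "(((\<lambda>x. c x y) \<circ> chart_inv A) has_derivative (\<lambda>v. - (v \<bullet> covec M c x0 y))) (at z0)"
      if "y \<in> \<Omega>'" for y
    proof -
      have "cost_pd_exists A (chart_at M' y) c [Inl undefined] x0 y"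
        using C3_cost_inside(1)[OF C3 A(1) chart_at(1)[OF M(2)] C3_words(2)] x A(2) that
          chart_at(2)[OF M(2)] by blast
      then have "chart_differentiable A (\<lambda>x. c x y) x0"
        by simp
      from chart_differentiable_has_derivative[OF this] show ?thesis
        by (simp add: inner_vec_def covec_def A_def[symmetric] sum_negf z0_def)
    qed
    show ?thesis
      using has_derivative_add[OF has_derivative_minus[OF d[OF y(2)]] d[OF y(1)]]
      by (simp add: f_def w_def o_def inner_diff_right)
  qed
  define \<phi> where "\<phi> = (\<lambda>s::real. (f \<circ> chart_inv A) (h (q x0 + s *\<^sub>R b)))"
  have hq: "h (q x0) = z0"
    using hF[OF z0(1)] Fz0 by simp
  have "(\<phi> has_real_derivative ((P' *v b) \<bullet> w)) (at 0)"
  proof -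
    have 1: "((\<lambda>s. q x0 + s *\<^sub>R b) has_derivative (\<lambda>s. s *\<^sub>R b)) (at (0::real))"
      by (auto intro!: derivative_eq_intros)
    have 2: "(h has_derivative (*v) P') (at ((\<lambda>s::real. q x0 + s *\<^sub>R b) 0))"
      using derh by simp
    have 3: "((f \<circ> chart_inv A) has_derivative (\<lambda>v. v \<bullet> w)) (at ((h \<circ> (\<lambda>s::real. q x0 + s *\<^sub>R b)) 0))"
      using derf by (simp add: hq)
    have "(\<lambda>v. v \<bullet> w) \<circ> ((*v) P' \<circ> (\<lambda>s. s *\<^sub>R b)) = (*) ((P' *v b) \<bullet> w)"
      by (auto simp: fun_eq_iff matrix_vector_mult_scaleR)
    then show ?thesis
      using diff_chain_at[OF diff_chain_at[OF 1 2] 3]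
      by (simp add: has_field_derivative_def \<phi>_def o_def)
  qed
  then have lim: "((\<lambda>s. (\<phi> s - \<phi> 0) / s) \<longlongrightarrow> (P' *v b) \<bullet> w) (at_right 0)"
    unfolding has_field_derivative_iff by (simp add: filterlim_at_split)
  have ev: "eventually (\<lambda>s. (\<phi> s - \<phi> 0) / s \<le> M0 * k) (at_right 0)"
  proof -
    have "((\<lambda>s. q x0 + s *\<^sub>R b) \<longlongrightarrow> q x0 + 0 *\<^sub>R b) (at_right (0::real))"
      by (intro tendsto_intros)
    moreover have "q x0 + 0 *\<^sub>R b \<in> F ` U"
      using imageI[OF z0(1), of F] Fz0 by simp
    ultimately have "eventually (\<lambda>s. q x0 + s *\<^sub>R b \<in> F ` U) (at_right (0::real))"
      using FU topological_tendstoD by blast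
    moreover have "eventually (\<lambda>s::real. s \<in> {0<..<1}) (at_right 0)"
      by (rule eventually_at_right_real) simp
    ultimately show ?thesis
    proof eventually_elim
      case (elim s)
      then obtain z where z: "z \<in> U" "q x0 + s *\<^sub>R b = F z"
        by blast
      define xs where "xs = chart_inv A z"
      have xs: "xs \<in> \<Omega>"
        using inv(1)[OF z(1)] by (simp add: xs_def)
      have "c_segment M' (flip c) \<Omega> y0 x0 x1 s = xs"
      proof (rule c_segment_eq)
        show "inj_on (covec M' (flip c) y0) \<Omega>"
          using injq by (simp add: q_def)
        show "covec M' (flip c) y0 xs
            = (1 - s) *\<^sub>R covec M' (flip c) y0 x0 + s *\<^sub>R covec M' (flip c) y0 x1"
          using z(2) by (simp add: F_def xs_def b_def q_def algebra_simps)
      qed (rule xs)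
      then have "- c xs y1 + c x0 y1 - (- c xs y0 + c x0 y0)
          \<le> M0 * s * max 0 (- c x1 y1 + c x0 y1 - (- c x1 y0 + c x0 y0))"
        using qq x y elim(2) unfolding QQConv_def Let_def
        by (metis atLeastAtMost_iff greaterThanLessThan_iff less_imp_le)
      also have "\<dots> \<le> M0 * s * k"
        using M0 elim(2) k by (intro mult_left_mono) auto
      finally have "- c xs y1 + c x0 y1 - (- c xs y0 + c x0 y0) \<le> M0 * s * k" .
      moreover have "\<phi> s = f xs"
        using hF[OF z(1)] by (simp add: \<phi>_def z(2) xs_def)
      moreover have "\<phi> 0 = f x0"
        by (simp add: \<phi>_def hq z0(2))
      ultimately have "\<phi> s - \<phi> 0 \<le> M0 * k * s"
        by (simp add: f_def algebra_simps)
      then show ?case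
        using elim(2) by (simp add: divide_le_eq)
    qed
  qed
  have "(P' *v b) \<bullet> w \<le> M0 * k"
    by (rule tendsto_upperbound[OF lim ev]) simp
  then show ?thesis
    by (simp add: P'_def P_def b_def w_def q_def)
qed

text \<open>The reason for the factor \<open>2 M0\<close> in the dilation: \<open>x0\<close> sits on the \<open>c\<close>-segment from \<open>z\<close> to \<open>x1\<close>
at the time \<open>s = 1 / (2 M0)\<close>, where \<open>M0 s = 1/2\<close>. With \<open>f = -c(\<sqdot>,y1) + c(\<sqdot>,y0)\<close>,
\<open>f x0 - f z\<close> is at most half of the positive part of
\<open>f x1 - f z = (f x1 - f x0) + (f x0 - f z)\<close>, and the last term can be absorbed on the left.\<close>

lemma QQConv_gap_le_of_dilation:
  assumes tw: "Twist M M' \<Omega> \<Omega>' c" and qq: "QQConv M M' \<Omega> \<Omega>' c M0" and M0: "1 \<le> M0"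
    and x: "z \<in> \<Omega>" "x0 \<in> \<Omega>" "x1 \<in> \<Omega>" and y: "y0 \<in> \<Omega>'" "y1 \<in> \<Omega>'"
    and dil: "covec M' (flip c) y0 x1 = covec M' (flip c) y0 z
       + (2 * M0) *\<^sub>R (covec M' (flip c) y0 x0 - covec M' (flip c) y0 z)"
    and h: "- c x1 y1 + c x0 y1 - (- c x1 y0 + c x0 y0) \<le> h" "0 \<le> h"
  shows "- c x0 y1 + c z y1 - (- c x0 y0 + c z y0) \<le> h"
proof -
  define s where "s = 1 / (2 * M0)"
  have s: "0 \<le> s" "s \<le> 1" "M0 * s = 1 / 2"
    using M0 by (auto simp: s_def)
  have "c_segment M' (flip c) \<Omega> y0 z x1 s = x0"
  proof (rule c_segment_eq)
    show "inj_on (covec M' (flip c) y0) \<Omega>"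
      using tw y by (simp add: Twist_def)
    have "s * (2 * M0) = 1"
      using M0 by (simp add: s_def)
    then show "covec M' (flip c) y0 x0 = (1 - s) *\<^sub>R covec M' (flip c) y0 z + s *\<^sub>R covec M' (flip c) y0 x1"
      by (simp add: dil algebra_simps)
  qed (rule x)
  then have "- c x0 y1 + c z y1 - (- c x0 y0 + c z y0)
      \<le> M0 * s * max 0 (- c x1 y1 + c z y1 - (- c x1 y0 + c z y0))"
    using qq x y s(1,2) unfolding QQConv_def Let_def by (metis atLeastAtMost_iff)
  then show ?thesis
    using h by (simp add: s(3) max_def split: if_splits)
qed

text \<open>The \<open>c\<close>-function with focus \<open>y1\<close> supporting \<open>u\<close> at \<open>x0\<close> lies below \<open>u\<close>, hence below \<open>m\<close>, at \<open>x1\<close>.\<close>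

lemma c_subdifferential_gap_le:
  assumes "y1 \<in> c_subdifferential c \<Omega> \<Omega>' u x0" and "c_function c \<Omega> y m"
    and "x0 \<in> \<Omega>" "x1 \<in> \<Omega>" "u x1 \<le> m x1"
  shows "- c x1 y1 + c x0 y1 - (- c x1 y + c x0 y) \<le> m x0 - u x0"
proof -
  obtain m1 l1 where m1: "\<forall>x\<in>\<Omega>. m1 x = - c x y1 + l1" "m1 x0 = u x0" "\<forall>x\<in>\<Omega>. m1 x \<le> u x"
    using assms(1) by (auto simp: c_subdifferential_def c_function_def supporting_def)
  obtain l where "\<forall>x\<in>\<Omega>. m x = - c x y + l"
    using assms(2) by (auto simp: c_function_def)
  moreover have "m1 x1 \<le> m x1"
    using m1(3) assms(4,5) by fastforce
  ultimately show ?thesis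
    using m1(1,2) assms(3,4) by simp
qed

section \<open>The polar ellipsoid\<close>

text \<open>The center belongs to the set itself, not only to its closure: it is interior to the inner
ellipsoid, and a convex set has the same interior as its closure.\<close>

lemma center_of_mass_ellipsoids:
  fixes S :: "(real ^ 'n::finite) set"
  assumes S: "convex S" and cm: "is_center_of_mass S p"
  obtains L where "invertible L" "ellipsoid p L \<subseteq> closure S"
    "S \<subseteq> ellipsoid p (real CARD('n) *\<^sub>R L)" "p \<in> S"
proof -
  obtain L where L: "invertible L" "ellipsoid p L \<subseteq> closure S" "S \<subseteq> ellipsoid p (real CARD('n) *\<^sub>R L)"
    using cm by (auto simp: is_center_of_mass_def)
  have "bij ((*v) L)"
    using L(1) by (rule invertible_eq_bij[THEN iffD1])
  then have "open ((*v) L ` ball 0 1)"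
    by (intro open_bijective_linear_image_eq[THEN iffD2] matrix_vector_mul_linear) auto
  then have "open ((+) p ` (*v) L ` ball 0 1)"
    by (rule open_translation)
  moreover have "(+) p ` (*v) L ` ball 0 1 \<subseteq> closure S"
    using L(2) by (force simp: ellipsoid_def)
  ultimately have "(+) p ` (*v) L ` ball 0 1 \<subseteq> interior (closure S)"
    by (rule interior_maximal[rotated])
  moreover have "p \<in> (+) p ` (*v) L ` ball 0 1"
    by (auto intro!: image_eqI[of _ _ 0])
  ultimately have "p \<in> interior S"
    using convex_interior_closure[OF S] by blast
  then show ?thesis
    using that L interior_subset by blast
qed

text \<open>A covector bounded by \<open>h\<close> on all displacements in \<open>S - p\<close> is bounded by \<open>h\<close> on the inner ellipsoid,
that is, it lies in \<open>h\<close> times the polar of this ellipsoid, which is again a linear image of a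
ball.\<close>

lemma covector_in_polar_ball:
  fixes P' :: "real ^ 'n::finite ^ 'n"
  assumes P': "invertible P'" and L: "invertible L" and E: "ellipsoid p L \<subseteq> closure S"
    and le: "\<And>a. a \<in> S \<Longrightarrow> (P' *v (a - p)) \<bullet> w \<le> h"
  shows "w \<in> (*v) (matrix_inv (transpose (P' ** L))) ` cball 0 h"
proof -
  define T where "T = transpose (P' ** L)"
  define t where "t = T *v w"
  have "closed {a. (P' *v (a - p)) \<bullet> w \<le> h}"
    by (intro closed_Collect_le continuous_intros
        bounded_linear.continuous_on[OF matrix_vector_mul_bounded_linear])
  then have cl: "closure S \<subseteq> {a. (P' *v (a - p)) \<bullet> w \<le> h}"
    using le by (intro closure_minimal) auto
  \<comment> \<open>the unit vector on which the functional \<open>t\<close> attains its norm\<close>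
  define v where "v = sgn t"
  have "p + L *v v \<in> ellipsoid p L"
    by (auto simp: ellipsoid_def v_def norm_sgn intro!: image_eqI[of _ _ v])
  then have "(P' *v (L *v v)) \<bullet> w \<le> h"
    using E cl by force
  moreover have "(P' *v (L *v v)) \<bullet> w = v \<bullet> t"
    using dot_lmul_matrix[of w "P' ** L" v] by (simp add: t_def T_def matrix_vector_mul_assoc inner_commute)
  moreover have "v \<bullet> t = norm t"
    by (cases "t = 0") (simp_all add: v_def sgn_div_norm dot_square_norm power2_eq_square)
  ultimately have "t \<in> cball 0 h" by simp
  moreover have "invertible T"
    using P' L by (simp add: T_def invertible_det_nz det_mul)
  then have "w = matrix_inv T *v t"
    by (simp add: t_def matrix_vector_mul_assoc matrix_inv_mult)
  ultimately show ?thesis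
    by (auto simp: T_def)
qed

section \<open>The sharp growth estimate\<close>

text \<open>The covector map \<open>-Dc(x,\<sqdot>)\<close> and its counterpart in the next lemma are injective by the twist
condition, and their Jacobians are comparable to the product of the two metric densities, one of
which is a constant because its base point is fixed.\<close>

lemma volume_covec_preimage_le:
  fixes M :: "('a::{t2_space,second_countable_topology}, 'n::finite) riem"
    and M' :: "('b::{t2_space,second_countable_topology}, 'n) riem"
  assumes M: "riemannian_manifold M" "riemannian_manifold M'" and \<mu>': "riemannian_volume M' \<mu>'"
    and op: "open \<Omega>" "open \<Omega>'" and C3: "C3_cost M M' \<Omega> \<Omega>' c"
    and tw: "Twist M M' \<Omega> \<Omega>' c" and nd: "Nondeg M M' \<Omega> \<Omega>' c"
    and mb: "mixed_bounds M M' \<Omega> \<Omega>' c K" and K: "0 \<le> K"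
    and x: "x \<in> \<Omega>" and E: "E \<in> sets borel"
  shows "outer_measure_of \<mu>' {y\<in>\<Omega>'. covec M c x y \<in> E}
           \<le> ennreal (K / sqrt (det (gmat M (chart_at M x) x))) * emeasure lborel E"
proof (rule riemannian_volume_preimage_le[OF M(2) \<mu>' op(2) _ E,
      where J = "\<lambda>B y. mixed_matrix \<Omega> \<Omega>' (chart_at M x) B c x y"])
  note A = chart_at[OF M(1), of x]
  have xA: "x \<in> \<Omega> \<inter> fst (chart_at M x)"
    using x A by simp
  have g: "sqrt (det (gmat M (chart_at M x) x)) > 0"
    using sqrt_det_gmat_pos[OF M(1) A] .
  show "0 \<le> K / sqrt (det (gmat M (chart_at M x) x))"
    using g K by simp
  show "inj_on (covec M c x) \<Omega>'"
    using tw x by (simp add: Twist_def)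
  fix B assume B: "B \<in> atlas M'"
  have "continuous_on (\<Omega>' \<inter> fst B) (\<lambda>y. (\<lambda>(z, y). mixed_matrix \<Omega> \<Omega>' (chart_at M x) B c z y) (x, y))"
    by (rule continuous_on_compose2[OF continuous_on_mixed_matrix[OF C3 A(1) B]]) (use xA in \<open>auto intro!: continuous_intros\<close>)
  then show "continuous_on (\<Omega>' \<inter> fst B) (mixed_matrix \<Omega> \<Omega>' (chart_at M x) B c x)"
    by simp
  fix y assume y: "y \<in> \<Omega>' \<inter> fst B"
  show "((covec M c x \<circ> chart_inv B) has_derivative (*v) (mixed_matrix \<Omega> \<Omega>' (chart_at M x) B c x y)) (at (snd B y))"
    by (rule covec_has_derivative[OF M(1) C3 B x y])
  show "sqrt (det (gmat M' B y))
      \<le> K / sqrt (det (gmat M (chart_at M x) x)) * \<bar>det (mixed_matrix \<Omega> \<Omega>' (chart_at M x) B c x y)\<bar>"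
    using mixed_matrix_bounds(2)[OF M nd mb A(1) B xA y] g by (simp add: field_simps)
qed

lemma volume_covec_flip_preimage_le:
  fixes M :: "('a::{t2_space,second_countable_topology}, 'n::finite) riem"
    and M' :: "('b::{t2_space,second_countable_topology}, 'n) riem"
  assumes M: "riemannian_manifold M" "riemannian_manifold M'" and \<mu>: "riemannian_volume M \<mu>"
    and op: "open \<Omega>" "open \<Omega>'" and C3: "C3_cost M M' \<Omega> \<Omega>' c"
    and tw: "Twist M M' \<Omega> \<Omega>' c" and nd: "Nondeg M M' \<Omega> \<Omega>' c"
    and mb: "mixed_bounds M M' \<Omega> \<Omega>' c K" and K: "0 \<le> K"
    and y: "y \<in> \<Omega>'" and E: "E \<in> sets borel"
  shows "outer_measure_of \<mu> {x\<in>\<Omega>. covec M' (flip c) y x \<in> E}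
           \<le> ennreal (K / sqrt (det (gmat M' (chart_at M' y) y))) * emeasure lborel E"
proof (rule riemannian_volume_preimage_le[OF M(1) \<mu> op(1) _ E,
      where J = "\<lambda>A x. transpose (mixed_matrix \<Omega> \<Omega>' A (chart_at M' y) c x y)"])
  note B = chart_at[OF M(2), of y]
  have yB: "y \<in> \<Omega>' \<inter> fst (chart_at M' y)"
    using y B by simp
  have g: "sqrt (det (gmat M' (chart_at M' y) y)) > 0"
    using sqrt_det_gmat_pos[OF M(2) B] .
  show "inj_on (covec M' (flip c) y) \<Omega>"
    using tw y by (simp add: Twist_def)
  show "0 \<le> K / sqrt (det (gmat M' (chart_at M' y) y))"
    using g K by simp
  fix A assume A: "A \<in> atlas M"
  have "continuous_on (\<Omega> \<inter> fst A) (\<lambda>x. (\<lambda>(x, z). mixed_matrix \<Omega> \<Omega>' A (chart_at M' y) c x z) (x, y))"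
    by (rule continuous_on_compose2[OF continuous_on_mixed_matrix[OF C3 A B(1)]]) (use yB in \<open>auto intro!: continuous_intros\<close>)
  then have "continuous_on (\<Omega> \<inter> fst A) (\<lambda>x. mixed_matrix \<Omega> \<Omega>' A (chart_at M' y) c x y)"
    by simp
  then show "continuous_on (\<Omega> \<inter> fst A) (\<lambda>x. transpose (mixed_matrix \<Omega> \<Omega>' A (chart_at M' y) c x y))"
    unfolding transpose_def by (intro continuous_on_vec_lambda continuous_on_component)
  fix x assume x: "x \<in> \<Omega> \<inter> fst A"
  show "((covec M' (flip c) y \<circ> chart_inv A) has_derivative
      (*v) (transpose (mixed_matrix \<Omega> \<Omega>' A (chart_at M' y) c x y))) (at (snd A x))"
    by (rule covec_flip_has_derivative[OF M C3 op A x y])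
  show "sqrt (det (gmat M A x)) \<le> K / sqrt (det (gmat M' (chart_at M' y) y))
      * \<bar>det (transpose (mixed_matrix \<Omega> \<Omega>' A (chart_at M' y) c x y))\<bar>"
    using mixed_matrix_bounds(2)[OF M nd mb A B(1) x yB] g by (simp add: field_simps)
qed

text \<open>The key confinement: as \<open>x0\<close> runs through \<open>A\<close>, all foci in \<open>\<partial>\<^sub>cu(x0)\<close> have covectors, at the one
point \<open>xc\<close>, in the same polar ellipsoid. With \<open>f = -c(\<sqdot>,y1) + c(\<sqdot>,y)\<close>, the function \<open>f\<close> exceeds
\<open>f x0\<close> by at most \<open>h\<close> on the dilated set; the dilation of \<open>x0\<close> gives \<open>f x0 - f xc \<le> h\<close>, so \<open>f\<close>
exceeds \<open>f xc\<close> by at most \<open>2 h\<close> there. The gradient of \<open>f\<close> at \<open>xc\<close> is then at most \<open>2 M0 h\<close> on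
the dilated displacements, and at most \<open>h\<close> on those of \<open>A\<close>.\<close>

lemma c_subdifferential_covec_in_polar_ball:
  fixes M :: "('a::{t2_space,second_countable_topology}, 'n::finite) riem"
    and M' :: "('b::{t2_space,second_countable_topology}, 'n) riem"
  assumes M: "riemannian_manifold M" "riemannian_manifold M'"
    and op: "open \<Omega>" "open \<Omega>'" and C3: "C3_cost M M' \<Omega> \<Omega>' c"
    and tw: "Twist M M' \<Omega> \<Omega>' c" and qq: "QQConv M M' \<Omega> \<Omega>' c M0" and M0: "1 \<le> M0"
    and y: "y \<in> \<Omega>'" and m: "c_function c \<Omega> y m" and A: "A \<subseteq> \<Omega>"
    and xc: "xc \<in> A"
    and dil: "dilated_covecs M' c y (covec M' (flip c) y xc) (2 * M0) A \<subseteq> covec M' (flip c) y ` \<Omega>"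
      "c_dilation M' c \<Omega> y (covec M' (flip c) y xc) (2 * M0) A \<subseteq> {x\<in>\<Omega>. u x \<le> m x}"
    and J: "J = mixed_matrix \<Omega> \<Omega>' (chart_at M xc) (chart_at M' y) c xc y" "invertible J"
    and L: "invertible L"
      "ellipsoid (covec M' (flip c) y xc) L \<subseteq> closure (covec M' (flip c) y ` A)"
    and h: "0 \<le> h" "\<And>x. x \<in> {x\<in>\<Omega>. u x \<le> m x} \<Longrightarrow> m x - u x \<le> h"
    and x0: "x0 \<in> A" and y1: "y1 \<in> c_subdifferential c \<Omega> \<Omega>' u x0"
  shows "covec M c xc y1 - covec M c xc y
           \<in> (*v) (matrix_inv (transpose (matrix_inv (transpose J) ** L))) ` cball 0 h"
proof (rule covector_in_polar_ball)
  let ?q = "covec M' (flip c) y"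
  show "invertible L" "ellipsoid (?q xc) L \<subseteq> closure (?q ` A)"
    using L by auto
  have "invertible (transpose J)"
    using J(2) by (simp add: invertible_det_nz)
  then show "invertible (matrix_inv (transpose J))"
    using matrix_inv_mult[of "transpose J"] unfolding invertible_def by blast
  have injq: "inj_on ?q \<Omega>"
    using tw y by (simp add: Twist_def)
  have y1': "y1 \<in> \<Omega>'"
    using y1 by (simp add: c_subdifferential_def)
  have x0': "x0 \<in> \<Omega>" "xc \<in> \<Omega>"
    using x0 xc A by auto
  have dilate: "\<exists>x1\<in>\<Omega>. ?q x1 = ?q xc + (2 * M0) *\<^sub>R (?q a - ?q xc) \<and> u x1 \<le> m x1" if "a \<in> A" for a
  proof -
    have q1: "?q xc + (2 * M0) *\<^sub>R (?q a - ?q xc) \<in> dilated_covecs M' c y (?q xc) (2 * M0) A"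
      unfolding dilated_covecs_def using imageI[OF imageI[OF that]] .
    obtain x1 where x1: "x1 \<in> \<Omega>" "?q x1 = ?q xc + (2 * M0) *\<^sub>R (?q a - ?q xc)"
      using subsetD[OF dil(1) q1] by (elim imageE) (rule that, simp_all)
    have "c_exp M' (flip c) \<Omega> y (?q x1) \<in> c_dilation M' c \<Omega> y (?q xc) (2 * M0) A"
      unfolding c_dilation_def x1(2) using q1 by (rule imageI)
    then have "x1 \<in> {x\<in>\<Omega>. u x \<le> m x}"
      using dil(2) c_exp_covec[OF injq x1(1)] by auto
    with x1 show ?thesis by auto
  qed
  have mu: "m x0 - u x0 \<le> h"
    \<comment> \<open>if \<open>x0\<close> lies outside the section, the left-hand side is negative\<close>
    using h x0'(1) by (cases "u x0 \<le> m x0") auto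
  have gap: "- c x1 y1 + c x0 y1 - (- c x1 y + c x0 y) \<le> h" if "x1 \<in> \<Omega>" "u x1 \<le> m x1" for x1
    using c_subdifferential_gap_le[where u = u and m = m, OF y1 m x0'(1) that] mu by simp
  have gap0: "- c x0 y1 + c xc y1 - (- c x0 y + c xc y) \<le> h"
  proof -
    obtain x1 where "x1 \<in> \<Omega>" "?q x1 = ?q xc + (2 * M0) *\<^sub>R (?q x0 - ?q xc)" "u x1 \<le> m x1"
      using dilate[OF x0] by blast
    then show ?thesis
      using QQConv_gap_le_of_dilation[OF tw qq M0 x0'(2,1) _ y y1' _ gap h(1)] by blast
  qed
  show "(matrix_inv (transpose J) *v (b - ?q xc)) \<bullet> (covec M c xc y1 - covec M c xc y) \<le> h"
    if "b \<in> ?q ` A" for b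
  proof -
    obtain a where a: "a \<in> A" "b = ?q a"
      using \<open>b \<in> ?q ` A\<close> by blast
    obtain x1 where x1: "x1 \<in> \<Omega>" "?q x1 = ?q xc + (2 * M0) *\<^sub>R (?q a - ?q xc)" "u x1 \<le> m x1"
      using dilate[OF a(1)] by blast
    have "- c x1 y1 + c xc y1 - (- c x1 y + c xc y) \<le> 2 * h"
      using gap[OF x1(1,3)] gap0 by simp
    then have "(matrix_inv (transpose J) *v (?q x1 - ?q xc)) \<bullet> (covec M c xc y1 - covec M c xc y) \<le> M0 * (2 * h)"
      using h(1) by (intro QQConv_gradient_le[OF M op C3 tw qq M0 x0'(2) x1(1) y y1' J]) auto
    then have "(2 * M0) * ((matrix_inv (transpose J) *v (b - ?q xc)) \<bullet> (covec M c xc y1 - covec M c xc y)) \<le> (2 * M0) * h"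
      by (simp add: x1(2) a(2) matrix_vector_mult_scaleR mult_ac)
    then show ?thesis
      using M0 by simp
  qed
qed

text \<open>An ellipsoid of determinant \<open>L\<close> (dilated by \<open>n\<close>) and a polar one of determinant
\<open>J / L\<close> are multiplied, so \<open>L\<close> cancels; the remaining \<open>J / (g g')\<close> is bounded by \<open>K\<close>.\<close>

lemma product_of_polar_volumes_le:
  fixes n :: nat
  assumes K: "0 \<le> K" and g: "0 < g" "0 < g'" and h: "0 \<le> h" and v: "0 \<le> v"
    and J: "\<bar>J\<bar> \<le> K * (g * g')" and L: "L \<noteq> 0"
    and a: "a \<le> ennreal (K / g') * ennreal (\<bar>real n ^ n * L\<bar> * v)"
    and b: "b \<le> ennreal (K / g) * ennreal (\<bar>J / L\<bar> * v * h ^ n)"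
  shows "a * b \<le> ennreal (K ^ 3 * real n ^ n * v\<^sup>2 * h ^ n)"
proof -
  have mult4: "ennreal r * ennreal s * (ennreal t * ennreal u) = ennreal (r * s * (t * u))"
    if "0 \<le> r" "0 \<le> s" "0 \<le> t" "0 \<le> u" for r s t u
    using that by (simp add: ennreal_mult)
  have "a * b \<le> (ennreal (K / g') * ennreal (\<bar>real n ^ n * L\<bar> * v)) * (ennreal (K / g) * ennreal (\<bar>J / L\<bar> * v * h ^ n))"
    using a b by (rule mult_mono) auto
  also have "\<dots> = ennreal ((K / g' * (\<bar>real n ^ n * L\<bar> * v)) * (K / g * (\<bar>J / L\<bar> * v * h ^ n)))"
    using K g h v by (intro mult4) simp_all
  also have "(K / g' * (\<bar>real n ^ n * L\<bar> * v)) * (K / g * (\<bar>J / L\<bar> * v * h ^ n))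
      = (K\<^sup>2 * real n ^ n * v\<^sup>2 * h ^ n) * (\<bar>J\<bar> / (g * g'))"
    using g L by (simp add: abs_mult field_simps power2_eq_square)
  also have "\<dots> \<le> (K\<^sup>2 * real n ^ n * v\<^sup>2 * h ^ n) * K"
    using J g K h by (intro mult_left_mono) (simp_all add: divide_le_eq mult.commute)
  also have "\<dots> = K ^ 3 * real n ^ n * v\<^sup>2 * h ^ n"
    by (simp add: power3_eq_cube power2_eq_square)
  finally show ?thesis
    by (simp add: ennreal_leI)
qed

lemma det_scaleR:
  fixes L :: "real ^ 'n::finite ^ 'n"
  shows "det (r *\<^sub>R L) = r ^ CARD('n) * det L"
proof -
  have "r *\<^sub>R L = (\<chi> i. r *s L $ i)"
    by (simp add: vec_eq_iff)
  then show ?thesis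
    using det_rows_mul[of "\<lambda>_. r" "\<lambda>i. L $ i"] by simp
qed

theorem lemma3p7:
  fixes M :: "('a::{t2_space,second_countable_topology}, 'n::finite) riem"
    and M' :: "('b::{t2_space,second_countable_topology}, 'n) riem"
    and \<mu> :: "'a measure" and \<mu>' :: "'b measure"
    and \<Omega> X :: "'a set" and \<Omega>' X' :: "'b set"
    and \<alpha>1 \<alpha>2 M0 K :: real
  assumes "riemannian_manifold M" and "riemannian_manifold M'"
    and "riemannian_volume M \<mu>" and "riemannian_volume M' \<mu>'"
    and "domain_with_compact_closure \<Omega>" and "domain_with_compact_closure \<Omega>'"
    and "X \<subseteq> \<Omega>" and "X' \<subseteq> \<Omega>'"
    and "0 < \<alpha>1" and "\<alpha>1 \<le> \<alpha>2" and "1 \<le> M0"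
  shows "\<exists>C>0. \<forall>(c :: 'a \<Rightarrow> 'b \<Rightarrow> real) (\<rho> :: 'a \<Rightarrow> real) (\<rho>' :: 'b \<Rightarrow> real).
      prob_density_with_support \<mu> \<rho> X \<and> prob_density_with_support \<mu>' \<rho>' X' \<and>
      (AE (x, y) in \<mu> \<Otimes>\<^sub>M \<mu>'. x \<in> X \<and> y \<in> X' \<longrightarrow> \<alpha>1 \<le> \<rho> x / \<rho>' y \<and> \<rho> x / \<rho>' y \<le> \<alpha>2) \<and>
      C3_cost M M' \<Omega> \<Omega>' c \<and> Twist M M' \<Omega> \<Omega>' c \<and> Nondeg M M' \<Omega> \<Omega>' c \<and>
      DomConv M M' \<Omega> \<Omega>' X' c \<and> QQConv M M' \<Omega> \<Omega>' c M0 \<and>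
      mixed_bounds M M' \<Omega> \<Omega>' c K \<and> C3_norm_le M M' \<Omega> \<Omega>' c K
      \<longrightarrow>
      (\<forall>u m y S A p.
         c_convex_function c \<Omega> \<Omega>' u \<and> y \<in> \<Omega>' \<and> c_function c \<Omega> y m \<and>
         S = {x\<in>\<Omega>. u x \<le> m x} \<and> outer_measure_of \<mu> S > 0 \<and>
         A \<subseteq> \<Omega> \<and> outer_measure_of \<mu> A > 0 \<and> c_convex_wrt M' (flip c) A y \<and>
         is_center_of_mass (covec M' (flip c) y ` A) p \<and>
         dilated_covecs M' c y p (2 * M0) A \<subseteq> covec M' (flip c) y ` \<Omega> \<and>
         c_dilation M' c \<Omega> y p (2 * M0) A \<subseteq> S
         \<longrightarrow>
         (SUP x\<in>S. ennreal ((m x - u x) ^ CARD('n)))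
           \<ge> ennreal (1 / C) * outer_measure_of \<mu> A
               * outer_measure_of \<mu>' (\<Union>x\<in>A. c_subdifferential c \<Omega> \<Omega>' u x))"
proof -
  define v where "v = unit_ball_vol (real CARD('n))"
  define C where "C = 1 + \<bar>K\<bar> ^ 3 * real CARD('n) ^ CARD('n) * v\<^sup>2"
  have v: "0 \<le> v" by (simp add: v_def)
  have C: "C > 0" by (simp add: C_def add_pos_nonneg)
  have op: "open \<Omega>" "open \<Omega>'"
    using assms(5,6) by (simp_all add: domain_with_compact_closure_def)
  note M = assms(1,2)
  show ?thesis
  proof (intro exI[of _ C] conjI C allI impI, elim conjE, goal_cases)
    case (1 c \<rho> \<rho>' u m y S A p)
    note C3 = \<open>C3_cost M M' \<Omega> \<Omega>' c\<close> and tw = \<open>Twist M M' \<Omega> \<Omega>' c\<close> and nd = \<open>Nondeg M M' \<Omega> \<Omega>' c\<close>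
      and qq = \<open>QQConv M M' \<Omega> \<Omega>' c M0\<close> and mb = \<open>mixed_bounds M M' \<Omega> \<Omega>' c K\<close>
      and y = \<open>y \<in> \<Omega>'\<close> and m = \<open>c_function c \<Omega> y m\<close> and S = \<open>S = {x \<in> \<Omega>. u x \<le> m x}\<close> and A = \<open>A \<subseteq> \<Omega>\<close>
    define H where "H = (SUP x\<in>S. ennreal ((m x - u x) ^ CARD('n)))"
    define Z where "Z = (\<Union>x\<in>A. c_subdifferential c \<Omega> \<Omega>' u x)"
    let ?q = "covec M' (flip c) y"
    have "ennreal (1 / C) * (outer_measure_of \<mu> A * outer_measure_of \<mu>' Z) \<le> H"
    proof (cases H)
      case (real r)
      define h where "h = root CARD('n) r"
      have h: "0 \<le> h" "h ^ CARD('n) = r"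
        using real by (simp_all add: h_def)
      have mu: "m x - u x \<le> h" if "x \<in> {x\<in>\<Omega>. u x \<le> m x}" for x
      proof -
        have "ennreal ((m x - u x) ^ CARD('n)) \<le> H"
          unfolding H_def using that S by (intro SUP_upper) simp
        then have "(m x - u x) ^ CARD('n) \<le> h ^ CARD('n)"
          using real by (simp add: h(2))
        then show ?thesis
          using h(1) by (rule power_le_imp_le_base[where n = "CARD('n) - 1", simplified])
      qed
      have "convex (?q ` A)"
        using \<open>c_convex_wrt M' (flip c) A y\<close> by (simp add: c_convex_wrt_def)
      from center_of_mass_ellipsoids[OF this \<open>is_center_of_mass (?q ` A) p\<close>]
      obtain L where L: "invertible L" "ellipsoid p L \<subseteq> closure (?q ` A)"
        "?q ` A \<subseteq> ellipsoid p (real CARD('n) *\<^sub>R L)" and "p \<in> ?q ` A" .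
      then obtain xc where xc: "xc \<in> A" "p = ?q xc"
        by blast
      then have xc': "xc \<in> \<Omega>"
        using A by blast
      note dil = \<open>dilated_covecs M' c y p (2 * M0) A \<subseteq> ?q ` \<Omega>\<close>[unfolded xc(2)]
        \<open>c_dilation M' c \<Omega> y p (2 * M0) A \<subseteq> S\<close>[unfolded xc(2) S]
      define A0 where "A0 = chart_at M xc"
      define B0 where "B0 = chart_at M' y"
      define J where "J = mixed_matrix \<Omega> \<Omega>' A0 B0 c xc y"
      have A0: "A0 \<in> atlas M" "xc \<in> \<Omega> \<inter> fst A0" and B0: "B0 \<in> atlas M'" "y \<in> \<Omega>' \<inter> fst B0"
        using chart_at[OF M(1), of xc] chart_at[OF M(2), of y] xc' y by (auto simp: A0_def B0_def)
      note bnd = mixed_matrix_bounds[OF M nd mb A0(1) B0(1) A0(2) B0(2), folded J_def]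
      define g where "g = sqrt (det (gmat M A0 xc))"
      define g' where "g' = sqrt (det (gmat M' B0 y))"
      have g: "0 < g" "0 < g'"
        using sqrt_det_gmat_pos[OF M(1) A0(1)] sqrt_det_gmat_pos[OF M(2) B0(1)] A0(2) B0(2)
        by (auto simp: g_def g'_def)
      \<comment> \<open>\<open>E\<close> contains the covectors of \<open>A\<close> at \<open>y\<close>, and \<open>E'\<close> those of the foci at \<open>xc\<close>.\<close>
      define Q where "Q = matrix_inv (transpose (matrix_inv (transpose J) ** L))"
      define E where "E = (\<lambda>w. p + (real CARD('n) *\<^sub>R L) *v w) ` cball 0 1"
      define E' where "E' = (\<lambda>w. covec M c xc y + Q *v w) ` cball 0 h"
      have borel: "E \<in> sets borel" "E' \<in> sets borel"
        unfolding E_def E'_def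
        by (intro borel_compact compact_continuous_image continuous_intros
            linear_continuous_on matrix_vector_mul_bounded_linear compact_cball)+
      have detL: "det L \<noteq> 0"
        using L(1) by (simp add: invertible_det_nz)
      have detJ: "det J \<noteq> 0"
        using bnd(1) by (simp add: invertible_det_nz)
      have detinv: "det (matrix_inv T) = 1 / det T" if "det T \<noteq> 0" for T :: "real ^ 'n ^ 'n"
      proof -
        have "det T * det (matrix_inv T) = 1"
          using that matrix_inv_mult(1)[of T] by (metis det_I det_mul invertible_det_nz)
        then show ?thesis using that by (simp add: field_simps)
      qed
      have detQ: "det Q = det J / det L" "invertible Q"
        using detL detJ by (simp_all add: Q_def detinv det_mul invertible_det_nz)
      have "outer_measure_of \<mu> A \<le> outer_measure_of \<mu> {x\<in>\<Omega>. ?q x \<in> E}"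
        using A L(3) by (intro outer_measure_of_mono) (auto simp: E_def ellipsoid_def)
      also have "\<dots> \<le> ennreal (K / g') * emeasure lborel E"
        using volume_covec_flip_preimage_le[OF M assms(3) op C3 tw nd mb bnd(4) y borel(1)]
        by (simp add: g'_def B0_def)
      also have "\<dots> \<le> ennreal (K / g') * ennreal (\<bar>real CARD('n) ^ CARD('n) * det L\<bar> * v)"
        using emeasure_affine_image_cball_le[of "real CARD('n) *\<^sub>R L" 1 p] detL
        by (intro mult_left_mono) (simp_all add: E_def det_scaleR invertible_det_nz v_def)
      finally have muA: "outer_measure_of \<mu> A \<le> \<dots>" .
      have "Z \<subseteq> {y1\<in>\<Omega>'. covec M c xc y1 \<in> E'}"
      proof
        fix y1 assume "y1 \<in> Z"
        then obtain x0 where x0: "x0 \<in> A" "y1 \<in> c_subdifferential c \<Omega> \<Omega>' u x0"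
          by (auto simp: Z_def)
        have "covec M c xc y1 - covec M c xc y \<in> (*v) Q ` cball 0 h"
          unfolding Q_def
          by (rule c_subdifferential_covec_in_polar_ball[OF M op C3 tw qq \<open>1 \<le> M0\<close> y m A xc(1) dil
                J_def[unfolded A0_def B0_def] bnd(1) L(1) L(2)[unfolded xc(2)] h(1) mu x0])
        then obtain v1 where "v1 \<in> cball 0 h" "covec M c xc y1 - covec M c xc y = Q *v v1"
          by blast
        then have "covec M c xc y1 \<in> E'"
          unfolding E'_def by (intro image_eqI[of _ _ v1]) (simp_all add: algebra_simps)
        then show "y1 \<in> {y1\<in>\<Omega>'. covec M c xc y1 \<in> E'}"
          using x0(2) by (simp add: c_subdifferential_def)
      qed
      then have "outer_measure_of \<mu>' Z \<le> outer_measure_of \<mu>' {y1\<in>\<Omega>'. covec M c xc y1 \<in> E'}"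
        by (rule outer_measure_of_mono)
      also have "\<dots> \<le> ennreal (K / g) * emeasure lborel E'"
        using volume_covec_preimage_le[OF M assms(4) op C3 tw nd mb bnd(4) xc' borel(2)]
        by (simp add: g_def A0_def)
      also have "\<dots> \<le> ennreal (K / g) * ennreal (\<bar>det J / det L\<bar> * v * h ^ CARD('n))"
        using emeasure_affine_image_cball_le[OF detQ(2) h(1), of "covec M c xc y"]
        by (intro mult_left_mono) (simp_all add: E'_def detQ(1) v_def)
      finally have muZ: "outer_measure_of \<mu>' Z \<le> \<dots>" .
      have "outer_measure_of \<mu> A * outer_measure_of \<mu>' Z \<le> ennreal (K ^ 3 * real CARD('n) ^ CARD('n) * v\<^sup>2 * h ^ CARD('n))"
        by (rule product_of_polar_volumes_le[OF bnd(4) g h(1) v _ detL muA muZ])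
          (use bnd(3) in \<open>simp add: g_def g'_def\<close>)
      also have "\<dots> \<le> ennreal (C * r)"
        using bnd(4) h by (intro ennreal_leI) (auto simp: C_def intro!: mult_right_mono)
      finally have "ennreal (1 / C) * (outer_measure_of \<mu> A * outer_measure_of \<mu>' Z) \<le> ennreal (1 / C) * ennreal (C * r)"
        by (rule mult_left_mono) simp
      also have "\<dots> = ennreal r"
        using C real by (simp flip: ennreal_mult)
      finally show ?thesis
        using real by simp
    qed simp
    then show ?case
      by (simp add: H_def Z_def mult.assoc)
  qed
qed

end
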